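(* Assume $V$ is positive definite, that $i_n$, $n\ge0$, are i.i.d. uniformly distributed on $\{1,\dots,d\}$, and let $h$ be a $(\kappa,\gamma,V)$-Lipschitz function on $\mathbb R^d$ with $m=E(h(X))$, $X\sim N(0,V)$. Then, as $n\to\infty$, $$n\,E\Big(\Big(\frac{\sum_{j=0}^{n-1}h(X_j)}{n}-m\Big)^2\Big)\longrightarrow c,$$ where $c=\mathrm{Var}(h(\sqrt V Z_0))+2\sum_{j=1}^\infty\mathrm{Cov}(h(\sqrt V Z_0),h(\sqrt V Z_j))$.
   Context: Let $d\ge1$ and let $V$ be a real symmetric positive semi-definite $d\times d$ matrix whose diagonal entries all equal $1$. Write $\sqrt V$ for its symmetric positive semi-definite square root and $I$ for the $d\times d$ identity matrix. Let $e_i$ be the $i$-th standard basis column vector of $\mathbb R^d$. Let $(i_n)_{n\ge0}$ be a sequence of indices in $\{1,\dots,d\}$. Let $(g_n)_{n\ge0}$ be i.i.d. standard Gaussian random variables, and let $Z_0$ be a $d$-dimensional vector of i.i.d. standard Gaussian random variables, with $(i_n)$, $(g_n)$ and $Z_0$ mutually independent. Define $X_0=0$ and $X_{n+1}=X_n+(g_n-e_{i_n}^TX_n)\,Ve_{i_n}$ for $n\ge0$. For $1\le i\le d$ let $f_i=\sqrt V e_i$ and $P_i=I-f_if_i^T$. Define $Y_0=0$ and $Y_{n+1}=P_{i_n}Y_n+g_nf_{i_n}$. Let $M_n=P_{i_{n-1}}\cdots P_{i_0}$ with $M_0=I$, and $Z_n=Y_n+M_nZ_0$ for $n\ge1$.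 For a vector $x$, $\|x\|$ is its Euclidean norm; for a centered random vector $Z$, $\mathrm{cov}(Z)=E(ZZ^T)$; $A\le B$ means $B-A$ is positive semi-definite. Given $\kappa>0$, $\gamma\in(0,1]$ and a $d\times d$ positive semi-definite matrix $W$, a real-valued Borel function $h$ on $\mathbb R^d$ is $(\kappa,\gamma,W)$-Lipschitz if $E((h(X)-h(X'))^2)\le\kappa^2(E\|X-X'\|^2)^{\gamma}$ for every centered Gaussian vector $(X,X')$ in $\mathbb R^{2d}$ ($X,X'$ each $d$-dimensional) with $\mathrm{cov}(X)\le W$ and $\mathrm{cov}(X')\le W$. *)

theory Defs
  imports "HOL-Probability.Probability"
begin

definition psd_mat :: "real^'n^'n \<Rightarrow> bool" where
  "psd_mat A \<longleftrightarrow> transpose A = A \<and> (\<forall>x. 0 \<le> x \<bullet> (A *v x))"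

definition pd_mat :: "real^'n^'n \<Rightarrow> bool" where
  "pd_mat A \<longleftrightarrow> transpose A = A \<and> (\<forall>x. x \<noteq> 0 \<longrightarrow> 0 < x \<bullet> (A *v x))"

definition mat_sqrt :: "real^'n^'n \<Rightarrow> real^'n^'n" where
  "mat_sqrt A = (THE S. psd_mat S \<and> S ** S = A)"

definition outer :: "real^'n \<Rightarrow> real^'n \<Rightarrow> real^'n^'n" where
  "outer u v = (\<chi> a b. u $ a * v $ b)"

definition fvec :: "real^'n^'n \<Rightarrow> 'n \<Rightarrow> real^'n" where
  "fvec V i = mat_sqrt V *v axis i 1"

definition Pmat :: "real^'n^'n \<Rightarrow> 'n \<Rightarrow> real^'n^'n" where
  "Pmat V i = mat 1 - outer (fvec V i) (fvec V i)"

primrec Xseq :: "real^'n^'n \<Rightarrow> (nat \<Rightarrow> 'a \<Rightarrow> 'n) \<Rightarrow> (nat \<Rightarrow> 'a \<Rightarrow> real) \<Rightarrow> nat \<Rightarrow> 'a \<Rightarrow> real^'n" where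
  "Xseq V I g 0 \<omega> = 0"
| "Xseq V I g (Suc n) \<omega> =
     Xseq V I g n \<omega> + (g n \<omega> - Xseq V I g n \<omega> $ I n \<omega>) *\<^sub>R (V *v axis (I n \<omega>) 1)"

primrec Yseq :: "real^'n^'n \<Rightarrow> (nat \<Rightarrow> 'a \<Rightarrow> 'n) \<Rightarrow> (nat \<Rightarrow> 'a \<Rightarrow> real) \<Rightarrow> nat \<Rightarrow> 'a \<Rightarrow> real^'n" where
  "Yseq V I g 0 \<omega> = 0"
| "Yseq V I g (Suc n) \<omega> = Pmat V (I n \<omega>) *v Yseq V I g n \<omega> + g n \<omega> *\<^sub>R fvec V (I n \<omega>)"

primrec Mseq :: "real^'n^'n \<Rightarrow> (nat \<Rightarrow> 'a \<Rightarrow> 'n) \<Rightarrow> nat \<Rightarrow> 'a \<Rightarrow> real^'n^'n" where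
  "Mseq V I 0 \<omega> = mat 1"
| "Mseq V I (Suc n) \<omega> = Pmat V (I n \<omega>) ** Mseq V I n \<omega>"

definition Zseq :: "real^'n^'n \<Rightarrow> (nat \<Rightarrow> 'a \<Rightarrow> 'n) \<Rightarrow> (nat \<Rightarrow> 'a \<Rightarrow> real) \<Rightarrow> ('a \<Rightarrow> real^'n) \<Rightarrow> nat \<Rightarrow> 'a \<Rightarrow> real^'n" where
  "Zseq V I g Z0 n \<omega> = Yseq V I g n \<omega> + Mseq V I n \<omega> *v Z0 \<omega>"

definition centered_normal_law :: "real measure \<Rightarrow> bool" where
  "centered_normal_law N \<longleftrightarrow>
     N = return borel 0 \<or> (\<exists>\<sigma>>0. N = density lborel (normal_density 0 \<sigma>))"

definition centered_gaussian_pair :: "((real^'n) \<times> (real^'n)) measure \<Rightarrow> bool" where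
  "centered_gaussian_pair Q \<longleftrightarrow> prob_space Q \<and> sets Q = sets borel \<and>
     (\<forall>u v. centered_normal_law (distr Q borel (\<lambda>p. u \<bullet> fst p + v \<bullet> snd p)))"

text \<open>(kappa, gamma, W)-Lipschitz.  cov(X) \<le> W is written as u^T cov(X) u \<le> u^T W u for all u.\<close>
definition gauss_lipschitz :: "real \<Rightarrow> real \<Rightarrow> real^'n^'n \<Rightarrow> (real^'n \<Rightarrow> real) \<Rightarrow> bool" where
  "gauss_lipschitz \<kappa> \<gamma> W h \<longleftrightarrow> h \<in> borel_measurable borel \<and>
     (\<forall>Q. centered_gaussian_pair Q \<and>
          (\<forall>u. (\<integral>p. (u \<bullet> fst p)\<^sup>2 \<partial>Q) \<le> u \<bullet> (W *v u)) \<and>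
          (\<forall>u. (\<integral>p. (u \<bullet> snd p)\<^sup>2 \<partial>Q) \<le> u \<bullet> (W *v u))
        \<longrightarrow> (\<integral>\<^sup>+p. ennreal ((h (fst p) - h (snd p))\<^sup>2) \<partial>Q)
              \<le> ennreal (\<kappa>\<^sup>2 * (\<integral>p. (norm (fst p - snd p))\<^sup>2 \<partial>Q) powr \<gamma>))"

end

theory Submission
  imports Defs
begin

text \<open>With \<open>S\<close> the square root of \<open>V\<close> one has \<open>X\<^sub>n = S Y\<^sub>n\<close>, and \<open>Z\<close> is the chain driven by the same
  indices and noise as \<open>Y\<close> but started from \<open>N(0, I)\<close>, which is invariant; so \<open>h (S Z\<^sub>n)\<close> is stationary.
  The difference \<open>Z\<^sub>n - Y\<^sub>n = M\<^sub>n Z\<^sub>0\<close> contracts: averaging over a uniform index, \<open>\<parallel>P\<^sub>i z\<parallel>\<^sup>2\<close> loses the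
  fraction \<open>z\<^sup>T V z / (d \<parallel>z\<parallel>\<^sup>2)\<close>, which is bounded below because \<open>V\<close> is positive definite. By the
  Lipschitz hypothesis, applied conditionally on the indices, \<open>h (X\<^sub>n) - h (S Z\<^sub>n)\<close> is geometrically
  small in \<open>L\<^sup>2\<close>. As \<open>X\<^sub>n\<close> is independent of \<open>Z\<^sub>0\<close>, this also makes the covariances of \<open>h (S Z\<^sub>0)\<close> and
  \<open>h (S Z\<^sub>n)\<close> summable, and replacing \<open>h (X\<^sub>n)\<close> by \<open>h (S Z\<^sub>n)\<close> does not change the limit.\<close>

section \<open>Square roots of positive definite matrices\<close>

text \<open>Passing from X to Y makes the geometry Euclidean: the unit diagonal of V turns each f_i
  into a unit vector and P_i into an orthogonal projection, so that a step replaces the component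
  along f_i by a fresh normal variable. This is why N(0, I) is invariant: a standard Gaussian vector
  has independent standard components in every orthonormal frame. A single projection contracts
  nothing on the hyperplane orthogonal to f_i; only averaging over the index gives a rate. The
  Lipschitz hypothesis, however, speaks of Gaussian pairs and must be used while the indices are
  frozen. It then yields a random bound \<kappa>^2 q^\<gamma>, where q is the conditional mean
  square distance, and what is known to decay is the mean of q. So the concave power is majorised by
  an affine function of q before averaging. Square integrability of h under N(0, V) is part of the
  work: it comes from the comparison at time 0, where X_0 = 0 and h(X_0) is a constant. The root of
  V is given by a definite description, so its existence and uniqueness have to be settled at the
  outset.\<close>

lemma symmetric_inner_matrix_vector:
  fixes A :: "real^'n^'n"
  assumes "transpose A = A"
  shows "x \<bullet> (A *v y) = (A *v x) \<bullet> y"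
  by (metis assms dot_lmul_matrix vector_transpose_matrix)

text \<open>The quadratic form attains its minimum on the compact unit sphere, and homogeneity does
  the rest. The constant serves twice: for the contraction that builds the square root, and for the
  rate at which the chain forgets its start.\<close>

lemma pd_mat_lower_bound:
  fixes A :: "real^'n^'n"
  assumes "pd_mat A"
  obtains l where "l > 0" "\<And>x. l * (norm x)\<^sup>2 \<le> x \<bullet> (A *v x)"
proof -
  let ?S = "sphere (0::real^'n) 1"
  have "continuous_on ?S (\<lambda>x. x \<bullet> (A *v x))"
    by (intro continuous_intros linear_continuous_on matrix_vector_mul_bounded_linear)
  moreover have "?S \<noteq> {}" by simp
  ultimately obtain u where u: "u \<in> ?S" "\<And>x. x \<in> ?S \<Longrightarrow> u \<bullet> (A *v u) \<le> x \<bullet> (A *v x)"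
    using continuous_attains_inf[of ?S "\<lambda>x. x \<bullet> (A *v x)"] by auto
  have "u \<noteq> 0" using u(1) by auto
  show ?thesis
  proof
    show "u \<bullet> (A *v u) > 0" using assms \<open>u \<noteq> 0\<close> by (auto simp: pd_mat_def)
    fix x :: "real^'n"
    show "u \<bullet> (A *v u) * (norm x)\<^sup>2 \<le> x \<bullet> (A *v x)"
    proof (cases "x = 0")
      case False
      have "u \<bullet> (A *v u) \<le> (x /\<^sub>R norm x) \<bullet> (A *v (x /\<^sub>R norm x))"
        by (rule u(2)) (use False in simp)
      also have "\<dots> = (x \<bullet> (A *v x)) / (norm x)\<^sup>2"
        by (simp add: matrix_vector_mult_scaleR power2_eq_square divide_inverse)
      finally show ?thesis using False by (simp add: field_simps)
    qed simp
  qed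
qed

text \<open>Writing the root of a suitably scaled \<open>A\<close> as \<open>I - R\<close> turns \<open>(I - R)\<^sup>2 = I - B\<close> into the
  fixed point equation \<open>R = (B + R\<^sup>2) / 2\<close>, a contraction of the operators of norm at most \<open>q < 1\<close>.\<close>

lemma pd_mat_has_sqrt:
  fixes A :: "real^'n^'n"
  assumes "pd_mat A"
  shows "\<exists>S. psd_mat S \<and> S ** S = A"
proof -
  obtain l where l: "l > 0" "\<And>x. l * (norm x)\<^sup>2 \<le> x \<bullet> (A *v x)"
    using pd_mat_lower_bound[OF assms] by blast
  have sym: "transpose A = A" using assms by (simp add: pd_mat_def)
  obtain K where K: "K > 0" "\<And>x. norm (A *v x) \<le> norm x * K"
    using bounded_linear.pos_bounded[OF matrix_vector_mul_bounded_linear[of A]] by blast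
  \<comment> \<open>With \<open>norm (A *v x) \<le> K * norm x\<close>, the square of the norm of x
    - t A x is at most 1 - 2 t l + t^2 K^2 times that of x. This choice of t minimises the factor,
    leaving 1 - t l. The \<open>max 0\<close> in q spares a proof that t l is at most 1.\<close>
  define t where "t = l / K\<^sup>2"
  have "t > 0" using l K by (simp add: t_def)
  define q where "q = sqrt (max 0 (1 - t * l))"
  have q: "0 \<le> q" "q < 1" using l(1) \<open>t > 0\<close> by (auto simp: q_def)
  define b where "b = (\<lambda>x. x - t *\<^sub>R (A *v x))"
  have "bounded_linear b" unfolding b_def
    by (intro bounded_linear_sub bounded_linear_ident bounded_linear_const_scaleR
        matrix_vector_mul_bounded_linear)
  define B where "B = Blinfun b"
  have B: "blinfun_apply B x = x - t *\<^sub>R (A *v x)" for x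
    unfolding B_def using bounded_linear_Blinfun_apply[OF \<open>bounded_linear b\<close>] by (simp add: b_def)
  have nB: "norm B \<le> q"
  proof (rule norm_blinfun_bound[OF q(1)])
    fix x
    have "(norm (blinfun_apply B x))\<^sup>2 = (norm x)\<^sup>2 - 2 * t * (x \<bullet> (A *v x)) + t\<^sup>2 * (norm (A *v x))\<^sup>2"
      unfolding B power2_norm_eq_inner by (simp add: inner_diff inner_commute power2_eq_square algebra_simps)
    also have "\<dots> \<le> (norm x)\<^sup>2 - 2 * t * (l * (norm x)\<^sup>2) + t\<^sup>2 * (norm x * K)\<^sup>2"
      using \<open>t > 0\<close> l(2) K(2)
      by (intro add_mono diff_mono mult_left_mono power_mono) auto
    also have "\<dots> = (1 - t * l) * (norm x)\<^sup>2"
      using K(1) by (simp add: t_def power2_eq_square field_simps)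
    also have "\<dots> \<le> max 0 (1 - t * l) * (norm x)\<^sup>2" by (intro mult_right_mono) auto
    also have "\<dots> = (q * norm x)\<^sup>2" by (simp add: q_def power_mult_distrib)
    finally show "norm (blinfun_apply B x) \<le> q * norm x"
      using q(1) by (auto intro: power2_le_imp_le)
  qed
  \<comment> \<open>Bounded operators replace matrices because the fixed point argument needs a
    complete space with a submultiplicative norm. Self-adjointness is put into C so that the fixed
    point inherits it.\<close>
  define C where "C = {R :: (real^'n) \<Rightarrow>\<^sub>L (real^'n). norm R \<le> q \<and>
      (\<forall>x y. blinfun_apply R x \<bullet> y = x \<bullet> blinfun_apply R y)}"
  define F where "F = (\<lambda>R :: (real^'n) \<Rightarrow>\<^sub>L (real^'n). (1/2) *\<^sub>R (B + (R o\<^sub>L R)))"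
  have "closed C"
    unfolding C_def
    by (intro closed_Collect_conj closed_Collect_all closed_Collect_le closed_Collect_eq continuous_intros)
  then have "Topological_Spaces.complete C" by (simp add: complete_eq_closed)
  moreover have "0 \<in> C" using q by (simp add: C_def)
  moreover have "F ` C \<subseteq> C"
  proof clarify
    fix R assume R: "R \<in> C"
    have "norm (F R) \<le> (1/2) * (norm B + norm R * norm R)"
      unfolding F_def norm_scaleR using norm_triangle_ineq[of B "R o\<^sub>L R"] norm_blinfun_compose[of R R] by simp
    also have "\<dots> \<le> (1/2) * (q + q * 1)"
      using R nB q by (intro mult_left_mono add_mono mult_mono) (auto simp: C_def)
    finally have "norm (F R) \<le> q" by simp
    moreover have "blinfun_apply (F R) x \<bullet> y = x \<bullet> blinfun_apply (F R) y" for x y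
      using R symmetric_inner_matrix_vector[OF sym, of x y]
      by (simp add: F_def C_def B blinfun.add_left blinfun.scaleR_left inner_add_left inner_add_right inner_diff_left inner_diff_right)
    ultimately show "F R \<in> C" by (simp add: C_def)
  qed
  moreover have "dist (F R) (F R') \<le> q * dist R R'" if "R \<in> C" "R' \<in> C" for R R'
  proof -
    have "F R - F R' = (1/2) *\<^sub>R ((R o\<^sub>L (R - R')) + ((R - R') o\<^sub>L R'))"
      by (rule blinfun_eqI) (simp add: F_def blinfun.add_left blinfun.scaleR_left blinfun.diff_left blinfun.diff_right algebra_simps)
    then have "norm (F R - F R') \<le> (1/2) * (norm R * norm (R - R') + norm (R - R') * norm R')"
      using norm_triangle_ineq[of "R o\<^sub>L (R - R')" "(R - R') o\<^sub>L R'"]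
        norm_blinfun_compose[of R "R - R'"] norm_blinfun_compose[of "R - R'" R'] by simp
    also have "\<dots> \<le> (1/2) * (q * norm (R - R') + norm (R - R') * q)"
      using that by (intro mult_left_mono add_mono mult_mono) (auto simp: C_def q)
    finally show ?thesis by (simp add: dist_norm)
  qed
  ultimately have "\<exists>!R\<in>C. F R = R"
    using q by (intro Banach_fix[of C q F]) auto
  then obtain R where R: "R \<in> C" "F R = R" by blast
  have nR: "norm (blinfun_apply R x) \<le> norm x" for x
  proof -
    have "norm (blinfun_apply R x) \<le> norm R * norm x" by (rule norm_blinfun)
    also have "\<dots> \<le> 1 * norm x" using R(1) q by (intro mult_right_mono) (auto simp: C_def)
    finally show ?thesis by simp
  qed
  have RR: "2 *\<^sub>R blinfun_apply R x = x - t *\<^sub>R (A *v x) + blinfun_apply R (blinfun_apply R x)" for x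
  proof -
    have "2 *\<^sub>R blinfun_apply (F R) x = blinfun_apply B x + blinfun_apply R (blinfun_apply R x)"
      by (simp add: F_def blinfun.add_left blinfun.scaleR_left)
    then show ?thesis using R(2) by (simp add: B)
  qed
  \<comment> \<open>The fixed point equation says I - 2 R + R^2 = t A, so dividing I - R by the root
    of t undoes the scaling. Positivity of T follows from R having norm at most 1.\<close>
  define T where "T = (\<lambda>x. (1 / sqrt t) *\<^sub>R (x - blinfun_apply R x))"
  have "bounded_linear T" unfolding T_def
    by (intro bounded_linear_const_scaleR bounded_linear_sub bounded_linear_ident blinfun.bounded_linear_right)
  then have linT: "linear T" by (rule bounded_linear.linear)
  define S where "S = matrix T"
  have S: "S *v x = T x" for x by (simp add: S_def matrix_works linT)
  have "T (T x) = A *v x" for x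
  proof -
    have "T (T x) = (1 / sqrt t) *\<^sub>R ((1 / sqrt t) *\<^sub>R (x - 2 *\<^sub>R blinfun_apply R x + blinfun_apply R (blinfun_apply R x)))"
      by (simp add: T_def blinfun.diff_right blinfun.scaleR_right algebra_simps scaleR_2)
    also have "\<dots> = (1 / sqrt t * (1 / sqrt t) * t) *\<^sub>R (A *v x)" unfolding RR by simp
    also have "1 / sqrt t * (1 / sqrt t) * t = 1" using \<open>t > 0\<close> by simp
    finally show ?thesis by simp
  qed
  then have SS: "S ** S = A"
    by (simp add: matrix_eq S flip: matrix_vector_mul_assoc)
  have Tsym: "T x \<bullet> y = x \<bullet> T y" for x y
    using R(1) by (simp add: T_def C_def inner_diff_left inner_diff_right)
  moreover have "transpose S = S"
  proof -
    have "S $ i $ j = axis i 1 \<bullet> T (axis j 1)" for i j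
      unfolding S[symmetric] by (simp add: inner_axis' matrix_vector_mult_basis column_def)
    then have "S $ i $ j = S $ j $ i" for i j
      using Tsym[of "axis j 1" "axis i 1"] by (simp add: inner_commute)
    then show ?thesis by (simp add: transpose_def vec_eq_iff)
  qed
  moreover have "0 \<le> x \<bullet> (S *v x)" for x
  proof -
    have "x \<bullet> blinfun_apply R x \<le> norm x * norm (blinfun_apply R x)" by (rule norm_cauchy_schwarz)
    also have "\<dots> \<le> norm x * norm x" using nR by (intro mult_left_mono) auto
    finally show ?thesis using \<open>t > 0\<close>
      by (simp add: S T_def inner_diff_right power2_norm_eq_inner[unfolded power2_eq_square])
  qed
  ultimately show ?thesis using SS by (auto simp: psd_mat_def)
qed

lemma psd_mat_kernel:
  fixes S :: "real^'n^'n"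
  assumes "psd_mat S" "S ** S = A" "pd_mat A" "S *v x = 0"
  shows "x = 0"
proof (rule ccontr)
  assume "x \<noteq> 0"
  then have "0 < x \<bullet> (A *v x)" using assms(3) by (simp add: pd_mat_def)
  moreover have "A *v x = 0"
    using assms(2,4) by (metis matrix_vector_mul_assoc matrix_vector_mult_0_right)
  ultimately show False by simp
qed

text \<open>Moving from x in the direction -S x changes the form by -2 s n to first order, where n
  is the squared norm of S x. A nonnegative form that vanishes at x leaves no room for this unless n
  = 0.\<close>

lemma psd_mat_quadratic_zero:
  fixes S :: "real^'n^'n"
  assumes "psd_mat S" "x \<bullet> (S *v x) = 0"
  shows "S *v x = 0"
proof -
  let ?y = "S *v x"
  have sym: "transpose S = S" and pos: "\<And>x. 0 \<le> x \<bullet> (S *v x)"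
    using assms by (auto simp: psd_mat_def)
  define a where "a = ?y \<bullet> (S *v ?y)"
  define n where "n = ?y \<bullet> ?y"
  have expand: "(x - s *\<^sub>R ?y) \<bullet> (S *v (x - s *\<^sub>R ?y)) = s\<^sup>2 * a - 2 * s * n" for s
    using assms(2) symmetric_inner_matrix_vector[OF sym, of x ?y]
    by (simp add: matrix_vector_mult_diff_distrib matrix_vector_mult_scaleR inner_diff a_def n_def
        algebra_simps power2_eq_square)
  have "0 \<le> s\<^sup>2 * a - 2 * s * n" for s
    using pos[of "x - s *\<^sub>R ?y"] unfolding expand .
  \<comment> \<open>The minimiser would be n / a; adding 1 to the denominator covers a = 0 and still
    makes the linear term win.\<close>
  note quad = this[of "n / (1 + a)"]
  have "0 \<le> a" using pos by (simp add: a_def)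
  have "n \<le> 0"
  proof -
    have "0 \<le> (n / (1 + a))\<^sup>2 * a - 2 * (n / (1 + a)) * n" by (rule quad)
    also have "\<dots> = n\<^sup>2 * (a / (1 + a)\<^sup>2 - 2 / (1 + a))" by (simp add: power2_eq_square algebra_simps)
    also have "a / (1 + a)\<^sup>2 - 2 / (1 + a) = - ((2 + a) / (1 + a)\<^sup>2)"
      using \<open>0 \<le> a\<close> by (simp add: power2_eq_square divide_simps)
    finally have "n\<^sup>2 * ((2 + a) / (1 + a)\<^sup>2) \<le> 0" by (simp only: mult_minus_right neg_0_le_iff_le)
    moreover have "(2 + a) / (1 + a)\<^sup>2 > 0" using \<open>0 \<le> a\<close> by simp
    ultimately have "n\<^sup>2 \<le> 0" by (simp only: mult_le_0_iff) linarith
    then show ?thesis by simp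
  qed
  then show ?thesis unfolding n_def by (metis inner_ge_zero inner_eq_zero_iff order_antisym)
qed

text \<open>For two roots \<open>S\<close>, \<open>T\<close> and \<open>D = S - T\<close> one has \<open>S D + D T = 0\<close>, and taking the trace of
  \<open>D (S D + D T)\<close> makes the nonnegative forms of \<open>S\<close> and \<open>T\<close> vanish on the range of \<open>D\<close>.\<close>

lemma pd_mat_sqrt_unique:
  fixes A :: "real^'n^'n"
  assumes pd: "pd_mat A" and S: "psd_mat S" "S ** S = A" and T: "psd_mat T" "T ** T = A"
  shows "S = T"
proof -
  define D where "D = S - T"
  have symS: "transpose S = S" and symT: "transpose T = T" using S T by (auto simp: psd_mat_def)
  have symD: "transpose D = D" using symS symT by (simp add: D_def transpose_def vec_eq_iff)
  have D0: "S ** D + D ** T = 0"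
  proof -
    have "(S ** D + D ** T) *v x = 0" for x
    proof -
      have "S *v (S *v x) = T *v (T *v x)" by (simp add: matrix_vector_mul_assoc S T)
      then show ?thesis
        by (simp add: D_def matrix_vector_mult_add_rdistrib matrix_vector_mult_diff_rdistrib
            matrix_vector_mult_diff_distrib flip: matrix_vector_mul_assoc)
    qed
    then show ?thesis by (simp add: matrix_eq)
  qed
  have "trace (D ** (S ** D)) + trace (D ** (D ** T)) = 0"
    using D0 by (simp flip: trace_add matrix_add_ldistrib) (simp add: trace_def)
  moreover have "trace (D ** (D ** T)) = trace (D ** (T ** D))"
    by (metis trace_mul_sym matrix_mul_assoc)
  moreover have tr: "trace (D ** (R ** D)) = (\<Sum>k\<in>UNIV. (D *v axis k 1) \<bullet> (R *v (D *v axis k 1)))" for R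
  proof -
    have "(D ** (R ** D)) $ k $ k = (D *v axis k 1) \<bullet> (R *v (D *v axis k 1))" for k
    proof -
      have "(D ** (R ** D)) $ k $ k = axis k 1 \<bullet> ((D ** (R ** D)) *v axis k 1)"
        by (simp add: inner_axis' matrix_vector_mult_basis column_def)
      also have "\<dots> = (D *v axis k 1) \<bullet> (R *v (D *v axis k 1))"
        using symmetric_inner_matrix_vector[OF symD] by (simp flip: matrix_vector_mul_assoc)
      finally show ?thesis .
    qed
    then show ?thesis by (simp add: trace_def)
  qed
  ultimately have "(\<Sum>k\<in>UNIV. (D *v axis k 1) \<bullet> (S *v (D *v axis k 1)))
      + (\<Sum>k\<in>UNIV. (D *v axis k 1) \<bullet> (T *v (D *v axis k 1))) = 0"
    by simp
  moreover have "0 \<le> (\<Sum>k\<in>UNIV. (D *v axis k 1) \<bullet> (T *v (D *v axis k 1)))"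
    using T by (intro sum_nonneg) (auto simp: psd_mat_def)
  moreover have nonneg: "\<And>k. 0 \<le> (D *v axis k 1) \<bullet> (S *v (D *v axis k 1))"
    using S by (auto simp: psd_mat_def)
  moreover have "0 \<le> (\<Sum>k\<in>UNIV. (D *v axis k 1) \<bullet> (S *v (D *v axis k 1)))"
    by (intro sum_nonneg nonneg)
  ultimately have "(\<Sum>k\<in>UNIV. (D *v axis k 1) \<bullet> (S *v (D *v axis k 1))) = 0" by linarith
  then have "(D *v axis k 1) \<bullet> (S *v (D *v axis k 1)) = 0" for k
    using nonneg by (subst (asm) sum_nonneg_eq_0_iff) auto
  \<comment> \<open>A vanishing form gives S D e_k = 0, and S is injective because its square is
    positive definite. Hence every column of D is zero.\<close>
  then have "D *v axis k 1 = 0" for k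
    using psd_mat_kernel[OF S pd] psd_mat_quadratic_zero[OF S(1)] by blast
  then have "D $ i $ k = 0" for i k
    by (metis matrix_vector_mult_basis column_def vec_lambda_beta zero_index)
  then show ?thesis by (simp add: D_def vec_eq_iff)
qed

text \<open>\<open>mat_sqrt\<close> is a definite description, so nothing can be said about it
  before existence and uniqueness are both known. Later arguments use the root only through these
  two equations.\<close>

lemma mat_sqrt_pd:
  fixes A :: "real^'n^'n"
  assumes "pd_mat A"
  shows "transpose (mat_sqrt A) = mat_sqrt A" "mat_sqrt A ** mat_sqrt A = A"
proof -
  obtain S where S: "psd_mat S \<and> S ** S = A" using pd_mat_has_sqrt[OF assms] by blast
  have "psd_mat (mat_sqrt A) \<and> mat_sqrt A ** mat_sqrt A = A"
    unfolding mat_sqrt_def by (rule theI[of _ S]) (use S pd_mat_sqrt_unique[OF assms] in blast)+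
  then show "transpose (mat_sqrt A) = mat_sqrt A" "mat_sqrt A ** mat_sqrt A = A"
    by (auto simp: psd_mat_def)
qed

section \<open>Averages of perturbed stationary sequences\<close>

text \<open>Young's inequality with a free weight t. The weight r^j later balances a fixed factor
  against a geometrically small one, and 1 / sqrt n balances a growing sum against a bounded
  one.\<close>

lemma mult_le_sum_squares:
  fixes a b t :: real
  assumes "t > 0"
  shows "2 * \<bar>a * b\<bar> \<le> t * a\<^sup>2 + b\<^sup>2 / t"
proof -
  have "0 \<le> (t * \<bar>a\<bar> - \<bar>b\<bar>)\<^sup>2 / t" using assms by simp
  also have "\<dots> = t * a\<^sup>2 + b\<^sup>2 / t - 2 * \<bar>a * b\<bar>"
    using assms by (simp add: power2_diff power_mult_distrib abs_mult field_simps power2_eq_square)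
  finally show ?thesis by simp
qed

lemma integrable_mult_of_squares:
  fixes f g :: "'a \<Rightarrow> real"
  assumes [measurable]: "f \<in> borel_measurable M" "g \<in> borel_measurable M"
    and "integrable M (\<lambda>x. (f x)\<^sup>2)" "integrable M (\<lambda>x. (g x)\<^sup>2)"
  shows "integrable M (\<lambda>x. f x * g x)"
proof (rule Bochner_Integration.integrable_bound[where f="\<lambda>x. (f x)\<^sup>2 + (g x)\<^sup>2"])
  show "AE x in M. norm (f x * g x) \<le> norm ((f x)\<^sup>2 + (g x)\<^sup>2)"
  proof (rule AE_I2)
    fix x show "norm (f x * g x) \<le> norm ((f x)\<^sup>2 + (g x)\<^sup>2)"
      using mult_le_sum_squares[of 1 "f x" "g x"] abs_ge_zero[of "f x * g x"] by simp
  qed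
qed (use assms in auto)

lemma integrable_square_add:
  fixes f g :: "'a \<Rightarrow> real"
  assumes "f \<in> borel_measurable M" "g \<in> borel_measurable M"
    and "integrable M (\<lambda>x. (f x)\<^sup>2)" "integrable M (\<lambda>x. (g x)\<^sup>2)"
  shows "integrable M (\<lambda>x. (f x + g x)\<^sup>2)"
  using integrable_mult_of_squares[OF assms] assms(3,4) unfolding power2_sum
  by (simp add: mult.assoc)

text \<open>Cauchy-Schwarz with weights r^j. The unweighted form would cost a factor n, whereas here
  the constant does not depend on the number of terms.\<close>

lemma square_sum_le_geometric:
  fixes b :: "nat \<Rightarrow> real"
  assumes "0 < r" "r < 1"
  shows "(\<Sum>j<n. b j)\<^sup>2 \<le> 1 / (1 - r) * (\<Sum>j<n. (b j)\<^sup>2 / r ^ j)"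
proof -
  have "(\<Sum>j<n. b j) = (\<Sum>j<n. sqrt (r ^ j) * (b j / sqrt (r ^ j)))"
    using assms by (intro sum.cong) auto
  also have "(\<dots>)\<^sup>2 \<le> (\<Sum>j<n. (sqrt (r ^ j))\<^sup>2) * (\<Sum>j<n. (b j / sqrt (r ^ j))\<^sup>2)"
    by (rule Cauchy_Schwarz_ineq_sum)
  also have "\<dots> = (\<Sum>j<n. r ^ j) * (\<Sum>j<n. (b j)\<^sup>2 / r ^ j)"
    using assms by (simp add: power_divide)
  also have "\<dots> \<le> 1 / (1 - r) * (\<Sum>j<n. (b j)\<^sup>2 / r ^ j)"
    using assms by (intro mult_right_mono sum_nonneg) (auto simp: sum_gp_strict divide_right_mono)
  finally show ?thesis .
qed

text \<open>Enlarging the square by one row and one column adds the lags 0 to n, the positive ones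
  twice. So the increment is a partial sum of the limit L, off by a geometric tail. Summing these
  tails shows that the double sum stays within a bounded distance of n L.\<close>

lemma double_sum_stationary_limit:
  fixes c :: "nat \<Rightarrow> real"
  assumes "\<And>k. \<bar>c k\<bar> \<le> K * r ^ k" "0 < r" "r < 1"
  shows "summable (\<lambda>k. c (Suc k))"
    and "(\<lambda>n. (\<Sum>i<n. \<Sum>j<n. c (if i \<le> j then j - i else i - j)) / real n)
      \<longlonglongrightarrow> c 0 + 2 * (\<Sum>k. c (Suc k))"
proof -
  have geo: "summable (\<lambda>k. K * r ^ (k + m))" for m
    using assms by (intro summable_mult summable_ignore_initial_segment summable_geometric) auto
  have sum_c: "summable (\<lambda>k. c (k + m))" for m
    by (rule summable_comparison_test'[OF geo[of m], of 0]) (use assms(1) in auto)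
  from sum_c[of 1] show sc: "summable (\<lambda>k. c (Suc k))" by simp
  define L where "L = c 0 + 2 * (\<Sum>k. c (Suc k))"
  define s where "s = (\<lambda>n. \<Sum>i<n. \<Sum>j<n. c (if i \<le> j then j - i else i - j))"
  have step: "s (Suc n) - s n = c 0 + 2 * (\<Sum>k<n. c (Suc k))" for n
  proof -
    have "s (Suc n) = s n + (\<Sum>i<n. c (n - i)) + (\<Sum>j<n. c (n - j)) + c 0"
      by (simp add: s_def sum.distrib)
    also have "(\<Sum>i<n. c (n - i)) = (\<Sum>k<n. c (Suc k))"
      by (subst sum.nat_diff_reindex[symmetric]) (auto intro!: sum.cong arg_cong[of _ _ c])
    finally show ?thesis by simp
  qed
  have "\<bar>s (Suc n) - s n - L\<bar> \<le> 2 * \<bar>K\<bar> / (1 - r) * r ^ n" for n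
  proof -
    have "s (Suc n) - s n - L = - 2 * (\<Sum>k. c (Suc (k + n)))"
      using suminf_split_initial_segment[OF sc, of n] unfolding step L_def by simp
    moreover have "\<bar>\<Sum>k. c (Suc (k + n))\<bar> \<le> (\<Sum>k. \<bar>K\<bar> * r ^ n * r ^ k)"
    proof -
      have "norm (\<Sum>k. c (Suc (k + n))) \<le> (\<Sum>k. \<bar>K\<bar> * r ^ n * r ^ k)"
      proof (rule norm_suminf_le)
        fix k
        have "\<bar>c (Suc (k + n))\<bar> \<le> K * r ^ Suc (k + n)" by (rule assms(1))
        also have "\<dots> \<le> \<bar>K\<bar> * r ^ (n + k)"
          using assms(2,3) by (intro mult_mono power_decreasing) auto
        finally show "norm (c (Suc (k + n))) \<le> \<bar>K\<bar> * r ^ n * r ^ k" by (simp add: power_add mult.assoc)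
      next
        show "summable (\<lambda>k. \<bar>K\<bar> * r ^ n * r ^ k)"
          using assms by (intro summable_mult summable_geometric) auto
      qed
      then show ?thesis by simp
    qed
    moreover have "(\<Sum>k. \<bar>K\<bar> * r ^ n * r ^ k) = \<bar>K\<bar> * r ^ n * (1 / (1 - r))"
      using assms by (subst suminf_mult) (auto simp: suminf_geometric summable_geometric)
    ultimately show ?thesis by (simp add: abs_mult)
  qed
  note inc = this
  have bound: "\<bar>s n - n * L\<bar> \<le> 2 * \<bar>K\<bar> / (1 - r) * (1 / (1 - r))" for n
  proof -
    have "\<bar>s n - n * L\<bar> \<le> (\<Sum>k<n. 2 * \<bar>K\<bar> / (1 - r) * r ^ k)"
    proof (induction n)
      case 0 then show ?case by (simp add: s_def)
    next
      case (Suc n)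
      have "s (Suc n) - Suc n * L = (s n - n * L) + (s (Suc n) - s n - L)"
        by (simp add: algebra_simps)
      then show ?case using Suc inc[of n] by (simp only: sum.lessThan_Suc)
    qed
    also have "\<dots> = 2 * \<bar>K\<bar> / (1 - r) * (\<Sum>k<n. r ^ k)" by (simp add: sum_distrib_left)
    also have "\<dots> \<le> 2 * \<bar>K\<bar> / (1 - r) * (1 / (1 - r))"
      using assms by (intro mult_left_mono) (auto simp: sum_gp_strict divide_right_mono)
    finally show ?thesis .
  qed
  have "(\<lambda>n. s n / n - L) \<longlonglongrightarrow> 0"
  proof (rule Lim_null_comparison)
    let ?B = "2 * \<bar>K\<bar> / (1 - r) * (1 / (1 - r))"
    show "(\<lambda>n. ?B / real n) \<longlonglongrightarrow> 0" by (rule lim_const_over_n)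
    show "eventually (\<lambda>n. norm (s n / n - L) \<le> ?B / n) sequentially"
      using eventually_gt_at_top[of 0]
    proof eventually_elim
      case (elim n)
      have "s n / n - L = (s n - n * L) / n" using elim by (simp add: field_simps)
      then show ?case using bound[of n] elim by (simp only: real_norm_def abs_divide abs_of_nat divide_right_mono)
    qed
  qed
  then show "(\<lambda>n. (\<Sum>i<n. \<Sum>j<n. c (if i \<le> j then j - i else i - j)) / real n)
      \<longlonglongrightarrow> c 0 + 2 * (\<Sum>k. c (Suc k))"
    by (simp add: LIM_zero_iff L_def s_def)
qed

text \<open>An error that is geometrically small in \<open>L\<^sup>2\<close> contributes a bounded amount to the sum, so after
  normalisation only the stationary sequence \<open>U\<close> matters; and the covariances of \<open>U\<close> decay
  geometrically because \<open>H j\<close> is uncorrelated with \<open>U 0\<close> and close to \<open>U j\<close>.\<close>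

lemma (in prob_space) scaled_mean_square_limit:
  fixes U H :: "nat \<Rightarrow> 'a \<Rightarrow> real"
  assumes U[measurable]: "\<And>j. U j \<in> borel_measurable M"
    and H[measurable]: "\<And>j. H j \<in> borel_measurable M"
    and U_sq: "\<And>j. integrable M (\<lambda>x. (U j x)\<^sup>2)"
    and HU_sq: "\<And>j. integrable M (\<lambda>x. (H j x - U j x)\<^sup>2)"
    and HU_bound: "\<And>j. expectation (\<lambda>x. (H j x - U j x)\<^sup>2) \<le> C * (r ^ j)\<^sup>2"
    and r: "0 < r" "r < 1"
    and U_mean: "\<And>j. expectation (U j) = m"
    and U_corr: "\<And>j k. expectation (\<lambda>x. U j x * U (j + k) x) = expectation (\<lambda>x. U 0 x * U k x)"
    and UH: "\<And>j. expectation (\<lambda>x. U 0 x * H j x) = m * expectation (H j)"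
  defines "cov \<equiv> \<lambda>j. expectation (\<lambda>x. (U 0 x - m) * (U j x - m))"
  shows "summable (\<lambda>j. cov (Suc j))"
    and "(\<lambda>n. real n * expectation (\<lambda>x. ((\<Sum>j<n. H j x) / real n - m)\<^sup>2))
      \<longlonglongrightarrow> cov 0 + 2 * (\<Sum>j. cov (Suc j))"
proof -
  have sq_int: "integrable M f" if "f \<in> borel_measurable M" "integrable M (\<lambda>x. (f x)\<^sup>2)" for f :: "'a \<Rightarrow> real"
    using integrable_mult_of_squares[of f M "\<lambda>_. 1"] that by simp
  define u where "u = (\<lambda>j x. U j x - m)"
  define b where "b = (\<lambda>j x. H j x - U j x)"
  have [measurable]: "u j \<in> borel_measurable M" "b j \<in> borel_measurable M" for j
    by (auto simp: u_def b_def)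
  have U_int: "integrable M (U j)" for j by (rule sq_int[OF U U_sq])
  have b_sq: "integrable M (\<lambda>x. (b j x)\<^sup>2)" for j using HU_sq by (simp add: b_def)
  have b_int: "integrable M (b j)" for j by (rule sq_int[OF _ b_sq]) simp
  have u_sq: "integrable M (\<lambda>x. (u j x)\<^sup>2)" for j
    using integrable_square_add[OF U, of "\<lambda>_. - m" j] U_sq by (simp add: u_def)
  have u_int: "integrable M (u j)" for j by (rule sq_int[OF _ u_sq]) simp
  have u0: "expectation (u j) = 0" for j
    using U_int U_mean[of j] by (simp add: u_def prob_space)
  have uu: "integrable M (\<lambda>x. u i x * u j x)" for i j
    by (rule integrable_mult_of_squares) (auto intro: u_sq)
  have cov_eq: "expectation (\<lambda>x. u i x * u (i + k) x) = cov k" for i k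
  proof -
    have e: "expectation (\<lambda>x. u i x * u j x) = expectation (\<lambda>x. U i x * U j x) - m * m" for i j
    proof -
      have "integrable M (\<lambda>x. U i x * U j x)"
        by (rule integrable_mult_of_squares) (auto intro: U_sq)
      moreover have "u i x * u j x = U i x * U j x - m * U i x - m * U j x + m * m" for x
        by (simp add: u_def algebra_simps)
      ultimately show ?thesis using U_int U_mean[of i] U_mean[of j] by (simp add: prob_space)
    qed
    show ?thesis using e[of i "i + k"] e[of 0 k] U_corr[of i k] by (simp add: cov_def u_def)
  qed
  have C: "0 \<le> C"
  proof -
    have "0 \<le> expectation (\<lambda>x. (H 0 x - U 0 x)\<^sup>2)" by simp
    then show ?thesis using HU_bound[of 0] by (simp only: power_0 power_one mult_1_right)
  qed
  have b_bound: "expectation (\<lambda>x. (b j x)\<^sup>2) \<le> C * (r ^ j)\<^sup>2" for j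
    using HU_bound by (simp add: b_def)
  \<comment> \<open>Young's inequality with weight r^j splits E|u_0 b_j| into r^j E(u_0^2) and
    E(b_j^2) / r^j; the second is at most C r^j as well.\<close>
  define K where "K = (expectation (\<lambda>x. (u 0 x)\<^sup>2) + C) / 2"
  have cov_bound: "\<bar>cov j\<bar> \<le> K * r ^ j" for j
  proof -
    have ub: "integrable M (\<lambda>x. u 0 x * b j x)"
      by (rule integrable_mult_of_squares) (auto intro: u_sq b_sq)
    have uH: "expectation (\<lambda>x. u 0 x * (H j x - m)) = 0"
    proof -
      have Hsq: "integrable M (\<lambda>x. (H j x)\<^sup>2)"
        using integrable_square_add[of "U j" M "b j"] U_sq b_sq by (simp add: b_def)
      have "integrable M (\<lambda>x. U 0 x * H j x)"
        by (rule integrable_mult_of_squares) (auto intro: U_sq Hsq)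
      moreover have "integrable M (H j)" by (rule sq_int[OF H Hsq])
      moreover have "u 0 x * (H j x - m) = U 0 x * H j x - m * H j x - m * u 0 x" for x
        by (simp add: u_def algebra_simps)
      ultimately show ?thesis using UH[of j] u0[of 0] u_int[of 0] by simp
    qed
    \<comment> \<open>Here u_j = (H_j - m) - b_j, and u_0 is centred and uncorrelated with H_j. Only
      the error b_j contributes to the covariance.\<close>
    have "cov j = expectation (\<lambda>x. u 0 x * u j x)" using cov_eq[of 0 j] by simp
    also have "\<dots> = expectation (\<lambda>x. u 0 x * (H j x - m) - u 0 x * b j x)"
      by (simp add: u_def b_def algebra_simps)
    also have "\<dots> = - expectation (\<lambda>x. u 0 x * b j x)"
    proof -
      have "integrable M (\<lambda>x. u 0 x * (H j x - m))"
        using Bochner_Integration.integrable_add[OF uu[of 0 j] ub]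
        by (simp add: u_def b_def algebra_simps)
      then show ?thesis using ub uH by simp
    qed
    finally have "2 * \<bar>cov j\<bar> = 2 * \<bar>expectation (\<lambda>x. u 0 x * b j x)\<bar>" by simp
    also have "\<dots> \<le> 2 * expectation (\<lambda>x. \<bar>u 0 x * b j x\<bar>)"
      using integral_abs_bound[of M "\<lambda>x. u 0 x * b j x"] by simp
    also have "\<dots> = expectation (\<lambda>x. 2 * \<bar>u 0 x * b j x\<bar>)" by simp
    also have "\<dots> \<le> expectation (\<lambda>x. r ^ j * (u 0 x)\<^sup>2 + (b j x)\<^sup>2 / r ^ j)"
      using ub u_sq b_sq r by (intro integral_mono mult_le_sum_squares) auto
    also have "\<dots> = r ^ j * expectation (\<lambda>x. (u 0 x)\<^sup>2) + expectation (\<lambda>x. (b j x)\<^sup>2) / r ^ j"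
      using u_sq b_sq by simp
    also have "\<dots> \<le> r ^ j * expectation (\<lambda>x. (u 0 x)\<^sup>2) + C * (r ^ j)\<^sup>2 / r ^ j"
      using b_bound r by (intro add_mono divide_right_mono) auto
    also have "\<dots> = 2 * (K * r ^ j)" using r by (simp add: K_def power2_eq_square field_simps)
    finally show ?thesis by simp
  qed
  show summable_cov: "summable (\<lambda>j. cov (Suc j))"
    by (rule double_sum_stationary_limit(1)[OF cov_bound r])
  define c where "c = cov 0 + 2 * (\<Sum>j. cov (Suc j))"
  define A where "A = (\<lambda>n x. \<Sum>j<n. u j x)"
  define B where "B = (\<lambda>n x. \<Sum>j<n. b j x)"
  have [measurable]: "A n \<in> borel_measurable M" "B n \<in> borel_measurable M" for n
    by (auto simp: A_def B_def)
  have A_sq_eq: "(A n x)\<^sup>2 = (\<Sum>i<n. \<Sum>j<n. u i x * u j x)" for n x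
    by (simp add: A_def power2_eq_square sum_product)
  have A_sq: "integrable M (\<lambda>x. (A n x)\<^sup>2)" for n
    unfolding A_sq_eq using uu by simp
  have EA: "expectation (\<lambda>x. (A n x)\<^sup>2) = (\<Sum>i<n. \<Sum>j<n. cov (if i \<le> j then j - i else i - j))" for n
  proof -
    have "expectation (\<lambda>x. (A n x)\<^sup>2) = (\<Sum>i<n. \<Sum>j<n. expectation (\<lambda>x. u i x * u j x))"
      unfolding A_sq_eq using uu by simp
    moreover have "expectation (\<lambda>x. u i x * u j x) = cov (if i \<le> j then j - i else i - j)" for i j
      using cov_eq[of i "j - i"] cov_eq[of j "i - j"] by (auto simp: mult.commute)
    ultimately show ?thesis by simp
  qed
  have A_lim: "(\<lambda>n. expectation (\<lambda>x. (A n x)\<^sup>2) / n) \<longlonglongrightarrow> c"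
    unfolding EA c_def by (rule double_sum_stationary_limit(2)[OF cov_bound r])
  \<comment> \<open>One factor 1 / (1 - r) comes from the weighted Cauchy-Schwarz inequality, the
    other from summing C r^(2j) / r^j.\<close>
  define D where "D = C / (1 - r)\<^sup>2"
  have "0 \<le> D" using C by (simp add: D_def)
  have bj_int: "integrable M (\<lambda>x. 1 / (1 - r) * (\<Sum>j<n. (b j x)\<^sup>2 / r ^ j))" for n
    using b_sq by simp
  have B_le: "(B n x)\<^sup>2 \<le> 1 / (1 - r) * (\<Sum>j<n. (b j x)\<^sup>2 / r ^ j)" for n x
    unfolding B_def by (rule square_sum_le_geometric[OF r])
  have B_sq: "integrable M (\<lambda>x. (B n x)\<^sup>2)" for n
  proof (rule Bochner_Integration.integrable_bound[OF bj_int[of n]])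
    show "AE x in M. norm ((B n x)\<^sup>2) \<le> norm (1 / (1 - r) * (\<Sum>j<n. (b j x)\<^sup>2 / r ^ j))"
      using B_le[of n] by (intro AE_I2) (metis abs_ge_self order_trans real_norm_def abs_of_nonneg zero_le_power2)
  qed simp
  have EB: "expectation (\<lambda>x. (B n x)\<^sup>2) \<le> D" for n
  proof -
    have "expectation (\<lambda>x. (B n x)\<^sup>2) \<le> expectation (\<lambda>x. 1 / (1 - r) * (\<Sum>j<n. (b j x)\<^sup>2 / r ^ j))"
      by (rule integral_mono[OF B_sq bj_int B_le])
    also have "\<dots> = 1 / (1 - r) * (\<Sum>j<n. expectation (\<lambda>x. (b j x)\<^sup>2) / r ^ j)"
      using b_sq by simp
    also have "\<dots> \<le> 1 / (1 - r) * (\<Sum>j<n. C * (r ^ j)\<^sup>2 / r ^ j)"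
      using b_bound r by (intro mult_left_mono sum_mono divide_right_mono) auto
    also have "\<dots> = 1 / (1 - r) * C * (\<Sum>j<n. r ^ j)"
      using r by (simp add: power2_eq_square sum_distrib_left)
    also have "\<dots> \<le> 1 / (1 - r) * C * (1 / (1 - r))"
      using r C by (intro mult_left_mono) (auto simp: sum_gp_strict divide_right_mono)
    also have "\<dots> = D" by (simp add: D_def power2_eq_square)
    finally show ?thesis .
  qed
  have AB_int: "integrable M (\<lambda>x. A n x * B n x)" for n
    by (rule integrable_mult_of_squares) (auto intro: A_sq B_sq)
  define Q where "Q = (\<lambda>n. real n * expectation (\<lambda>x. ((\<Sum>j<n. H j x) / real n - m)\<^sup>2))"
  have Q_eq: "Q n = (expectation (\<lambda>x. (A n x)\<^sup>2) + 2 * expectation (\<lambda>x. A n x * B n x)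
      + expectation (\<lambda>x. (B n x)\<^sup>2)) / n" if "n > 0" for n
  proof -
    have "(\<Sum>j<n. H j x) / real n - m = (A n x + B n x) / n" for x
      using that by (simp add: A_def B_def u_def b_def sum_subtractf field_simps)
    then have "Q n = real n * expectation (\<lambda>x. (A n x + B n x)\<^sup>2 / (real n)\<^sup>2)"
      by (simp add: Q_def power_divide)
    also have "\<dots> = expectation (\<lambda>x. (A n x)\<^sup>2 + 2 * (A n x * B n x) + (B n x)\<^sup>2) / n"
      using that by (simp add: power2_sum power2_eq_square algebra_simps)
    also have "expectation (\<lambda>x. (A n x)\<^sup>2 + 2 * (A n x * B n x) + (B n x)\<^sup>2)
        = expectation (\<lambda>x. (A n x)\<^sup>2) + 2 * expectation (\<lambda>x. A n x * B n x) + expectation (\<lambda>x. (B n x)\<^sup>2)"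
      using A_sq B_sq AB_int by simp
    finally show ?thesis .
  qed
  have "(\<lambda>n. Q n - expectation (\<lambda>x. (A n x)\<^sup>2) / n) \<longlonglongrightarrow> 0"
  proof (rule Lim_null_comparison)
    \<comment> \<open>The first two terms bound the cross term 2 E(A B) / n by Young's inequality
      with weight 1 / sqrt n. They vanish in the limit because E(A^2) / n converges and E(B^2) is
      bounded by D.\<close>
    let ?E = "\<lambda>n. (1 / sqrt (real n)) * (expectation (\<lambda>x. (A n x)\<^sup>2) / real n) + D * (1 / sqrt (real n)) + D / real n"
    have sq0: "(\<lambda>n. 1 / sqrt (real n)) \<longlonglongrightarrow> 0"
      by (intro tendsto_divide_0[OF tendsto_const] filterlim_at_top_imp_at_infinity
          filterlim_compose[OF sqrt_at_top] filterlim_real_sequentially)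
    have "?E \<longlonglongrightarrow> 0 * c + D * 0 + 0"
      by (intro tendsto_intros sq0 A_lim lim_const_over_n)
    then show "?E \<longlonglongrightarrow> 0" by simp
    show "eventually (\<lambda>n. norm (Q n - expectation (\<lambda>x. (A n x)\<^sup>2) / n) \<le> ?E n) sequentially"
      using eventually_gt_at_top[of 0]
    proof eventually_elim
      case (elim n)
      let ?t = "1 / sqrt (real n)"
      have t: "?t > 0" using elim by simp
      have "2 * \<bar>expectation (\<lambda>x. A n x * B n x)\<bar> \<le> 2 * expectation (\<lambda>x. \<bar>A n x * B n x\<bar>)"
        using integral_abs_bound[of M "\<lambda>x. A n x * B n x"] by simp
      also have "\<dots> = expectation (\<lambda>x. 2 * \<bar>A n x * B n x\<bar>)" by simp
      also have "\<dots> \<le> expectation (\<lambda>x. ?t * (A n x)\<^sup>2 + (B n x)\<^sup>2 / ?t)"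
        using AB_int A_sq B_sq by (intro integral_mono mult_le_sum_squares[OF t]) auto
      also have "\<dots> = ?t * expectation (\<lambda>x. (A n x)\<^sup>2) + expectation (\<lambda>x. (B n x)\<^sup>2) / ?t"
        using A_sq B_sq by simp
      also have "\<dots> \<le> ?t * expectation (\<lambda>x. (A n x)\<^sup>2) + D / ?t"
        using EB[of n] t by (intro add_mono divide_right_mono) auto
      finally have cross: "2 * \<bar>expectation (\<lambda>x. A n x * B n x)\<bar>
          \<le> ?t * expectation (\<lambda>x. (A n x)\<^sup>2) + D / ?t" .
      have nonneg: "0 \<le> expectation (\<lambda>x. (B n x)\<^sup>2)" by simp
      have "Q n - expectation (\<lambda>x. (A n x)\<^sup>2) / n
          = (2 * expectation (\<lambda>x. A n x * B n x) + expectation (\<lambda>x. (B n x)\<^sup>2)) / n"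
        using elim by (simp add: Q_eq add_divide_distrib)
      then have "\<bar>Q n - expectation (\<lambda>x. (A n x)\<^sup>2) / n\<bar>
          = \<bar>2 * expectation (\<lambda>x. A n x * B n x) + expectation (\<lambda>x. (B n x)\<^sup>2)\<bar> / n"
        by (simp only: abs_divide abs_of_nat)
      also have "\<dots> \<le> (?t * expectation (\<lambda>x. (A n x)\<^sup>2) + D / ?t + D) / n"
        using cross EB[of n] nonneg by (intro divide_right_mono) linarith+
      also have "\<dots> = ?E n"
        using elim by (simp add: add_divide_distrib real_div_sqrt) (simp add: frac_eq_eq mult.assoc)
      finally show ?case by simp
    qed
  qed
  from tendsto_add[OF this A_lim] have "Q \<longlonglongrightarrow> c" by simp
  then show "(\<lambda>n. real n * expectation (\<lambda>x. ((\<Sum>j<n. H j x) / real n - m)\<^sup>2))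
      \<longlonglongrightarrow> cov 0 + 2 * (\<Sum>j. cov (Suc j))"
    by (simp add: Q_def c_def)
qed

section \<open>Standard Gaussian vectors\<close>

lemma borel_measurable_vecI:
  fixes f :: "'a \<Rightarrow> real^'n"
  assumes "\<And>k. (\<lambda>x. f x $ k) \<in> borel_measurable N"
  shows "f \<in> borel_measurable N"
  unfolding borel_measurable_euclidean_space[of f]
  using assms by (auto simp: Basis_vec_def inner_axis)

text \<open>\<open>lborel\<close> is determined by the volumes of boxes, and a box is a product of
  intervals. This connects Lebesgue measure on vectors with product measures over the index type, in
  which independence is expressed.\<close>

lemma lborel_vec_eq_distr_PiM:
  "(lborel :: (real^'n) measure) = distr (\<Pi>\<^sub>M k\<in>UNIV. lborel) borel vec_lambda"
proof (rule lborel_eqI)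
  interpret product_sigma_finite "\<lambda>_::'n. lborel :: real measure" ..
  have [measurable]: "vec_lambda \<in> (\<Pi>\<^sub>M k\<in>(UNIV::'n set). lborel) \<rightarrow>\<^sub>M (borel :: (real^'n) measure)"
    by (rule borel_measurable_vecI) simp
  fix l u :: "real^'n"
  assume le: "\<And>b. b \<in> Basis \<Longrightarrow> l \<bullet> b \<le> u \<bullet> b"
  have le': "l $ k \<le> u $ k" for k
    using le[of "axis k 1"] by (force simp: inner_axis Basis_vec_def)
  have "vec_lambda -` box l u \<inter> space (\<Pi>\<^sub>M k\<in>(UNIV::'n set). lborel) = (\<Pi>\<^sub>E k\<in>UNIV. box (l $ k) (u $ k))"
    by (auto simp: space_PiM mem_box_cart PiE_iff)
  then have "emeasure (distr (\<Pi>\<^sub>M k\<in>UNIV. lborel) borel vec_lambda) (box l u)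
      = (\<Prod>k\<in>UNIV. emeasure lborel (box (l $ k) (u $ k)))"
    by (simp add: emeasure_distr emeasure_PiM)
  also have "\<dots> = ennreal (\<Prod>k\<in>UNIV. u $ k - l $ k)"
    using le' by (simp add: prod_ennreal)
  also have "(\<Prod>k\<in>UNIV. u $ k - l $ k) = (\<Prod>b\<in>Basis. (u - l) \<bullet> b)"
  proof -
    have "(\<Prod>b\<in>Basis. (u - l) \<bullet> b) = (\<Prod>b\<in>range (\<lambda>k. axis k 1). (u - l) \<bullet> b)"
      by (rule prod.cong) (auto simp: Basis_vec_def)
    also have "\<dots> = (\<Prod>k\<in>UNIV. u $ k - l $ k)"
      by (subst prod.reindex) (auto simp: inj_on_def axis_eq_axis inner_axis)
    finally show ?thesis by simp
  qed
  finally show "emeasure (distr (\<Pi>\<^sub>M k\<in>UNIV. lborel) borel vec_lambda) (box l u)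
      = ennreal (\<Prod>b\<in>Basis. (u - l) \<bullet> b)" .
qed simp

text \<open>Encoded as a density because its invariance is proved by changes of variables under
  Lebesgue measure; \<open>std_gauss_eq_distr_PiM\<close> recovers it as the law of independent
  standard normal coordinates.\<close>

definition std_gauss :: "(real^'n) measure" where
  "std_gauss = density lborel (\<lambda>x. ennreal (\<Prod>k\<in>UNIV. std_normal_density (x $ k)))"

lemma prod_std_normal_density:
  "(\<Prod>k\<in>UNIV. std_normal_density (x $ k)) = (1 / sqrt (2 * pi)) ^ CARD('n) * exp (- (norm x)\<^sup>2 / 2)"
  for x :: "real^'n"
proof -
  have "(\<Prod>k\<in>UNIV. std_normal_density (x $ k))
      = (\<Prod>k\<in>(UNIV::'n set). 1 / sqrt (2 * pi)) * (\<Prod>k\<in>UNIV. exp (- (x $ k)\<^sup>2 / 2))"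
    unfolding std_normal_density_def by (rule prod.distrib)
  also have "(\<Prod>k\<in>UNIV. exp (- (x $ k)\<^sup>2 / 2)) = exp (\<Sum>k\<in>UNIV. - (x $ k)\<^sup>2 / 2)"
    by (simp add: exp_sum)
  also have "(\<Sum>k\<in>UNIV. - (x $ k)\<^sup>2 / 2) = - (norm x)\<^sup>2 / 2"
    by (simp add: norm_vec_def L2_set_def sum_nonneg sum_negf sum_divide_distrib)
  finally show ?thesis by simp
qed

lemma sets_std_gauss [simp, measurable_cong]: "sets std_gauss = sets borel"
  by (simp add: std_gauss_def)

lemma space_std_gauss [simp]: "space std_gauss = UNIV"
  by (simp add: std_gauss_def)

text \<open>It suffices to compare rectangles. There the integrand is a product of functions of one
  coordinate each, so the integral factorises.\<close>

lemma PiM_density_lborel: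
  fixes f :: "'k::finite \<Rightarrow> real \<Rightarrow> real"
  assumes [measurable]: "\<And>k. f k \<in> borel_measurable borel" and nonneg: "\<And>k x. 0 \<le> f k x"
    and prob: "\<And>k. prob_space (density lborel (f k))"
  shows "(\<Pi>\<^sub>M k\<in>UNIV. density lborel (f k)) = density (\<Pi>\<^sub>M k\<in>UNIV. lborel) (\<lambda>x. \<Prod>k\<in>UNIV. ennreal (f k (x k)))"
proof (rule sym)
  interpret L: product_sigma_finite "\<lambda>_::'k. lborel :: real measure" ..
  interpret P: product_prob_space "\<lambda>k. density lborel (f k)" UNIV
    by (rule product_prob_spaceI) (rule prob)
  show "density (\<Pi>\<^sub>M k\<in>UNIV. lborel) (\<lambda>x. \<Prod>k\<in>UNIV. ennreal (f k (x k))) = (\<Pi>\<^sub>M k\<in>UNIV. density lborel (f k))"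
  proof (rule P.PiM_eqI)
    fix A :: "'k \<Rightarrow> real set" assume A: "\<And>k. k \<in> UNIV \<Longrightarrow> A k \<in> sets (density lborel (f k))"
    then have [measurable]: "A k \<in> sets borel" for k by simp
    have "emeasure (density (\<Pi>\<^sub>M k\<in>UNIV. lborel) (\<lambda>x. \<Prod>k\<in>UNIV. ennreal (f k (x k)))) (Pi\<^sub>E UNIV A)
        = (\<integral>\<^sup>+x. (\<Prod>k\<in>UNIV. ennreal (f k (x k))) * indicator (Pi\<^sub>E UNIV A) x \<partial>(\<Pi>\<^sub>M k\<in>UNIV. lborel))"
      by (subst emeasure_density) (auto intro!: sets_PiM_I_finite)
    also have "\<dots> = (\<integral>\<^sup>+x. (\<Prod>k\<in>UNIV. ennreal (f k (x k)) * indicator (A k) (x k)) \<partial>(\<Pi>\<^sub>M k\<in>UNIV. lborel))"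
      by (intro nn_integral_cong)
        (auto simp: prod.distrib indicator_def PiE_iff prod_zero_iff split: if_splits)
    also have "\<dots> = (\<Prod>k\<in>UNIV. \<integral>\<^sup>+x. ennreal (f k x) * indicator (A k) x \<partial>lborel)"
      by (rule L.product_nn_integral_prod) auto
    also have "\<dots> = (\<Prod>k\<in>UNIV. emeasure (density lborel (f k)) (A k))"
      by (intro prod.cong refl) (simp add: emeasure_density)
    finally show "emeasure (density (\<Pi>\<^sub>M k\<in>UNIV. lborel) (\<lambda>x. \<Prod>k\<in>UNIV. ennreal (f k (x k)))) (Pi\<^sub>E UNIV A)
      = (\<Prod>k\<in>UNIV. emeasure (density lborel (f k)) (A k))" .
  qed (auto intro!: sets_PiM_cong)
qed

lemma std_gauss_eq_distr_PiM:
  "(std_gauss :: (real^'n) measure) = distr (\<Pi>\<^sub>M k\<in>UNIV. density lborel std_normal_density) borel vec_lambda"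
proof -
  have [measurable]: "vec_lambda \<in> (\<Pi>\<^sub>M k\<in>(UNIV::'n set). lborel) \<rightarrow>\<^sub>M (borel :: (real^'n) measure)"
    by (rule borel_measurable_vecI) simp
  have "std_gauss = density (distr (\<Pi>\<^sub>M k\<in>UNIV. lborel) borel (vec_lambda :: _ \<Rightarrow> real^'n))
      (\<lambda>x. \<Prod>k\<in>UNIV. ennreal (std_normal_density (x $ k)))"
    by (simp add: std_gauss_def prod_ennreal flip: lborel_vec_eq_distr_PiM)
  also have "\<dots> = distr (density (\<Pi>\<^sub>M k\<in>UNIV. lborel) (\<lambda>x. \<Prod>k\<in>UNIV. ennreal (std_normal_density (x k)))) borel vec_lambda"
    by (subst density_distr) auto
  also have "density (\<Pi>\<^sub>M k\<in>UNIV. lborel) (\<lambda>x. \<Prod>k\<in>(UNIV::'n set). ennreal (std_normal_density (x k)))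
      = (\<Pi>\<^sub>M k\<in>UNIV. density lborel std_normal_density)"
    by (rule PiM_density_lborel[symmetric]) (auto intro: prob_space_normal_density)
  finally show ?thesis .
qed

lemma prob_space_std_gauss: "prob_space std_gauss"
  unfolding std_gauss_eq_distr_PiM
  by (intro prob_space.prob_space_distr prob_space_PiM prob_space_normal_density borel_measurable_vecI)
    simp_all

lemma nn_integral_lborel_translate:
  fixes a :: "'a::euclidean_space"
  assumes [measurable]: "f \<in> borel_measurable borel"
  shows "(\<integral>\<^sup>+x. f (a + x) \<partial>lborel) = (\<integral>\<^sup>+x. f x \<partial>lborel)"
  by (subst (2) lborel_distr_plus[of a, symmetric]) (simp add: nn_integral_distr)

text \<open>The map \<open>(z, t) \<mapsto> (z + (t - f \<bullet> z) f, f \<bullet> z)\<close> is a reflection of \<open>\<real>\<^sup>n \<times> \<real>\<close>; it is decomposed into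
  three shears, each of which preserves Lebesgue measure by translation invariance in one factor.\<close>

lemma nn_integral_std_gauss_resample:
  fixes f :: "real^'n"
  assumes f: "norm f = 1" and F[measurable]: "F \<in> borel_measurable borel"
  shows "(\<integral>\<^sup>+z. \<integral>\<^sup>+t. F (z + (t - f \<bullet> z) *\<^sub>R f) \<partial>density lborel std_normal_density \<partial>std_gauss)
    = (\<integral>\<^sup>+z. F z \<partial>std_gauss)"
proof -
  have ff: "f \<bullet> f = 1" using f by (simp add: norm_eq_1)
  define C where "C = (1 / sqrt (2 * pi)) ^ CARD('n)"
  define \<rho> where "\<rho> = (\<lambda>z :: real^'n. C * exp (- (norm z)\<^sup>2 / 2))"
  have [measurable]: "\<rho> \<in> borel_measurable borel" by (simp add: \<rho>_def)
  have \<rho>0: "0 \<le> \<rho> z" for z by (simp add: \<rho>_def C_def)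
  define K where "K = (\<lambda>(z :: real^'n) t. ennreal (\<rho> z * std_normal_density t))"
  have [measurable]: "(\<lambda>x. K (p x) (q x)) \<in> borel_measurable N"
    if [measurable]: "p \<in> borel_measurable N" "q \<in> borel_measurable N" for p q and N :: "'z measure"
    by (simp add: K_def)
  \<comment> \<open>The joint density of start and noise is radial, so the change of variables only
    has to preserve the Euclidean norm of the pair.\<close>
  have K_eq: "K z t = K z' t'" if "z \<bullet> z + t * t = z' \<bullet> z' + t' * t'" for z t z' t'
  proof -
    have "\<rho> z * std_normal_density t = C * (1 / sqrt (2 * pi)) * exp (- (z \<bullet> z + t * t) / 2)" for z t
      by (simp add: \<rho>_def std_normal_density_def dot_square_norm power2_eq_square add_divide_distrib
          diff_divide_distrib flip: exp_add)
    then show ?thesis unfolding K_def by (simp only: that)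
  qed
  have gauss: "std_gauss = density lborel (\<lambda>z. ennreal (\<rho> z))"
    by (simp add: std_gauss_def prod_std_normal_density \<rho>_def C_def)
  have "(\<integral>\<^sup>+z. \<integral>\<^sup>+t. F (z + (t - f \<bullet> z) *\<^sub>R f) \<partial>density lborel std_normal_density \<partial>std_gauss)
      = (\<integral>\<^sup>+z. \<integral>\<^sup>+t. K z t * F (z + (t - f \<bullet> z) *\<^sub>R f) \<partial>lborel \<partial>lborel)"
    by (simp add: gauss nn_integral_density K_def ennreal_mult' \<rho>0 mult.assoc nn_integral_cmult)
  also have "\<dots> = (\<integral>\<^sup>+z. \<integral>\<^sup>+t. K z (f \<bullet> z + t) * F (z + t *\<^sub>R f) \<partial>lborel \<partial>lborel)"
  proof (rule nn_integral_cong)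
    fix z
    show "(\<integral>\<^sup>+t. K z t * F (z + (t - f \<bullet> z) *\<^sub>R f) \<partial>lborel)
        = (\<integral>\<^sup>+t. K z (f \<bullet> z + t) * F (z + t *\<^sub>R f) \<partial>lborel)"
      using nn_integral_lborel_translate[of "\<lambda>t. K z t * F (z + (t - f \<bullet> z) *\<^sub>R f)" "f \<bullet> z"] by simp
  qed
  also have "\<dots> = (\<integral>\<^sup>+t. \<integral>\<^sup>+z. K z (f \<bullet> z + t) * F (z + t *\<^sub>R f) \<partial>lborel \<partial>lborel)"
    by (rule lborel_pair.Fubini'[symmetric]) measurable
  also have "\<dots> = (\<integral>\<^sup>+t. \<integral>\<^sup>+z. K z (- (f \<bullet> z) + t) * F z \<partial>lborel \<partial>lborel)"
  proof (rule nn_integral_cong)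
    fix t
    have "(\<integral>\<^sup>+z. K z (f \<bullet> z + t) * F (z + t *\<^sub>R f) \<partial>lborel)
        = (\<integral>\<^sup>+z. K (- (t *\<^sub>R f) + z) (f \<bullet> (- (t *\<^sub>R f) + z) + t) * F (- (t *\<^sub>R f) + z + t *\<^sub>R f) \<partial>lborel)"
      using nn_integral_lborel_translate[of "\<lambda>z. K z (f \<bullet> z + t) * F (z + t *\<^sub>R f)" "- (t *\<^sub>R f)"] by simp
    also have "\<dots> = (\<integral>\<^sup>+z. K z (- (f \<bullet> z) + t) * F z \<partial>lborel)"
    proof (rule nn_integral_cong)
      fix z
      \<comment> \<open>Because f is a unit vector, the second argument on the left is f . z, and
        both sides have squared norm |z|^2 + (t - f . z)^2.\<close>
      have "K (- (t *\<^sub>R f) + z) (f \<bullet> (- (t *\<^sub>R f) + z) + t) = K z (- (f \<bullet> z) + t)"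
        by (rule K_eq) (simp add: inner_add_left inner_add_right inner_diff_left inner_diff_right ff
            inner_commute algebra_simps)
      then show "K (- (t *\<^sub>R f) + z) (f \<bullet> (- (t *\<^sub>R f) + z) + t) * F (- (t *\<^sub>R f) + z + t *\<^sub>R f)
          = K z (- (f \<bullet> z) + t) * F z" by simp
    qed
    finally show "(\<integral>\<^sup>+z. K z (f \<bullet> z + t) * F (z + t *\<^sub>R f) \<partial>lborel) = (\<integral>\<^sup>+z. K z (- (f \<bullet> z) + t) * F z \<partial>lborel)" .
  qed
  also have "\<dots> = (\<integral>\<^sup>+z. \<integral>\<^sup>+t. K z (- (f \<bullet> z) + t) * F z \<partial>lborel \<partial>lborel)"
    by (rule lborel_pair.Fubini') measurable
  also have "\<dots> = (\<integral>\<^sup>+z. \<integral>\<^sup>+t. K z t * F z \<partial>lborel \<partial>lborel)"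
    by (rule nn_integral_cong, rule nn_integral_lborel_translate) measurable
  also have "\<dots> = (\<integral>\<^sup>+z. ennreal (\<rho> z) * F z \<partial>lborel)"
  proof (rule nn_integral_cong)
    fix z
    have "(\<integral>\<^sup>+t. ennreal (std_normal_density t) \<partial>lborel) = 1"
      using prob_space.emeasure_space_1[OF prob_space_normal_density[of 1 0]]
      by (simp add: emeasure_density)
    then show "(\<integral>\<^sup>+t. K z t * F z \<partial>lborel) = ennreal (\<rho> z) * F z"
      by (simp add: K_def ennreal_mult' \<rho>0 nn_integral_multc nn_integral_cmult)
  qed
  finally show ?thesis by (simp add: gauss nn_integral_density)
qed

lemma (in prob_space) std_normal_linear_combination:
  fixes X :: "'i \<Rightarrow> 'a \<Rightarrow> real"
  assumes A: "finite A" and ind: "indep_vars (\<lambda>_. borel) X A"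
    and X: "\<And>i. i \<in> A \<Longrightarrow> distr M borel (X i) = density lborel std_normal_density"
  shows "centered_normal_law (distr M borel (\<lambda>x. \<Sum>i\<in>A. c i * X i x))" (is ?law)
    and "integrable M (\<lambda>x. (\<Sum>i\<in>A. c i * X i x)\<^sup>2)" (is ?int)
    and "expectation (\<lambda>x. (\<Sum>i\<in>A. c i * X i x)\<^sup>2) = (\<Sum>i\<in>A. (c i)\<^sup>2)" (is ?var)
proof -
  \<comment> \<open>Normal densities require a positive deviation, so terms with coefficient 0 are
    discarded first. If none remains, the combination is 0 and its law is the point mass that
    \<open>centered_normal_law\<close> admits.\<close>
  define A' where "A' = {i\<in>A. c i \<noteq> 0}"
  have sub: "A' \<subseteq> A" "finite A'" using A by (auto simp: A'_def)
  have sum_eq: "(\<Sum>i\<in>A. c i * X i x) = (\<Sum>i\<in>A'. c i * X i x)" for x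
    using A by (intro sum.mono_neutral_right) (auto simp: A'_def)
  have sq_eq: "(\<Sum>i\<in>A. (c i)\<^sup>2) = (\<Sum>i\<in>A'. (c i)\<^sup>2)"
    using A by (intro sum.mono_neutral_right) (auto simp: A'_def)
  have "?law \<and> ?int \<and> ?var"
  proof (cases "A' = {}")
    case True
    then show ?thesis by (simp add: sum_eq sq_eq centered_normal_law_def)
  next
    case False
    define \<sigma> where "\<sigma> = sqrt (\<Sum>i\<in>A'. (c i)\<^sup>2)"
    have "\<sigma> > 0"
      using False sub(2) by (auto simp: \<sigma>_def A'_def intro!: sum_pos)
    have rv: "X i \<in> borel_measurable M" if "i \<in> A" for i
      using ind that by (auto simp: indep_vars_def)
    have ind': "indep_vars (\<lambda>_. borel) (\<lambda>i x. c i * X i x) A'"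
      by (rule indep_vars_compose2[OF indep_vars_subset[OF ind sub(1)]]) auto
    have nrm: "distributed M lborel (\<lambda>x. c i * X i x) (normal_density 0 \<bar>c i\<bar>)" if "i \<in> A'" for i
    proof -
      have "i \<in> A" using that sub by auto
      have "distributed M lborel (X i) std_normal_density"
        using X[OF \<open>i \<in> A\<close>] rv[OF \<open>i \<in> A\<close>] by (simp add: distributed_def cong: distr_cong)
      from normal_density_affine[OF this, of "c i" 0] show ?thesis
        using that by (simp add: A'_def)
    qed
    have D: "distributed M lborel (\<lambda>x. \<Sum>i\<in>A'. c i * X i x) (normal_density 0 \<sigma>)"
      using sum_indep_normal[OF sub(2) False ind' _ nrm]
      by (auto simp: \<sigma>_def A'_def)
    have "distr M borel (\<lambda>x. \<Sum>i\<in>A'. c i * X i x) = density lborel (normal_density 0 \<sigma>)"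
      using D by (simp add: distributed_def cong: distr_cong)
    then have ?law using \<open>\<sigma> > 0\<close> by (auto simp: sum_eq centered_normal_law_def)
    moreover have ?int
      using distributed_integrable[OF D, of "\<lambda>x. x\<^sup>2"] integrable_normal_moment[OF \<open>\<sigma> > 0\<close>, of 0 2]
      by (simp add: sum_eq)
    moreover have ?var
      using normal_distributed_variance[OF \<open>\<sigma> > 0\<close> D] normal_distributed_expectation[OF \<open>\<sigma> > 0\<close> D]
      by (simp add: sum_eq sq_eq \<sigma>_def sum_nonneg)
    ultimately show ?thesis by blast
  qed
  then show ?law ?int ?var by blast+
qed

section \<open>The projection walk\<close>

text \<open>One recursion for every sequence in play: start 0 gives Y, start Z_0 gives Z, and zero
  noise gives the product of projections applied to z. Indices and noise are plain arguments, so
  that the indices can be frozen.\<close>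

primrec walk :: "('n \<Rightarrow> real^'n) \<Rightarrow> (nat \<Rightarrow> 'n) \<Rightarrow> (nat \<Rightarrow> real) \<Rightarrow> real^'n \<Rightarrow> nat \<Rightarrow> real^'n" where
  "walk f i \<gamma> z 0 = z"
| "walk f i \<gamma> z (Suc n) =
     walk f i \<gamma> z n + (\<gamma> n - f (i n) \<bullet> walk f i \<gamma> z n) *\<^sub>R f (i n)"

text \<open>The recursion exposes the last step, while averaging over the indices and stationarity
  both condition on the first one.\<close>

lemma walk_Suc_shift:
  "walk f i \<gamma> z (Suc n)
    = walk f (\<lambda>n. i (Suc n)) (\<lambda>n. \<gamma> (Suc n)) (z + (\<gamma> 0 - f (i 0) \<bullet> z) *\<^sub>R f (i 0)) n"
  by (induction n) auto

lemma walk_superposition: "walk f i \<gamma> z n = walk f i \<gamma> 0 n + walk f i (\<lambda>_. 0) z n"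
  by (induction n) (auto simp: inner_add_right algebra_simps)

lemma norm_project_out:
  fixes v f :: "'a::real_inner"
  assumes "norm f = 1"
  shows "(norm (v - (f \<bullet> v) *\<^sub>R f))\<^sup>2 = (norm v)\<^sup>2 - (f \<bullet> v)\<^sup>2"
  using assms unfolding power2_norm_eq_inner
  by (simp add: norm_eq_1 inner_diff_left inner_diff_right inner_commute
      power2_eq_square)

lemma norm_walk_le:
  assumes "\<And>k. norm (f k) = 1"
  shows "norm (walk f i (\<lambda>_. 0) z n) \<le> norm z"
proof (induction n)
  case (Suc n)
  let ?x = "walk f i (\<lambda>_. 0) z n"
  have "walk f i (\<lambda>_. 0) z (Suc n) = ?x - (f (i n) \<bullet> ?x) *\<^sub>R f (i n)" by simp
  then have "(norm (walk f i (\<lambda>_. 0) z (Suc n)))\<^sup>2 \<le> (norm ?x)\<^sup>2"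
    using norm_project_out[OF assms, of ?x "i n"] by simp
  then show ?case using Suc by (meson norm_ge_zero order_trans power2_le_imp_le)
qed simp

text \<open>A projection is self-adjoint, so a step can be moved onto v: it leaves the coefficient f
  . v on the newest noise and continues with the projected v. Pythagoras accounts for the lost
  length. The coefficients depend on the indices but not on noise or start, which makes the walk
  Gaussian for frozen indices.\<close>

lemma inner_walk_eq_linear_combination:
  fixes f :: "'n \<Rightarrow> real^'n"
  assumes f: "\<And>k. norm (f k) = 1"
  shows "\<exists>\<alpha> \<beta>. (\<forall>\<gamma> z. v \<bullet> walk f i \<gamma> z n = (\<Sum>m<n. \<alpha> m * \<gamma> m) + \<beta> \<bullet> z)
    \<and> (\<Sum>m<n. (\<alpha> m)\<^sup>2) + (norm \<beta>)\<^sup>2 = (norm v)\<^sup>2"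
proof (induction n arbitrary: v)
  case 0
  show ?case by auto
next
  case (Suc n)
  let ?f = "f (i n)"
  obtain \<alpha> \<beta> where
    walk: "\<And>\<gamma> z. (v - (?f \<bullet> v) *\<^sub>R ?f) \<bullet> walk f i \<gamma> z n = (\<Sum>m<n. \<alpha> m * \<gamma> m) + \<beta> \<bullet> z"
    and nrm: "(\<Sum>m<n. (\<alpha> m)\<^sup>2) + (norm \<beta>)\<^sup>2 = (norm (v - (?f \<bullet> v) *\<^sub>R ?f))\<^sup>2"
    using Suc.IH[of "v - (?f \<bullet> v) *\<^sub>R ?f"] by blast
  let ?\<alpha> = "\<alpha>(n := ?f \<bullet> v)"
  have "v \<bullet> walk f i \<gamma> z (Suc n) = (\<Sum>m<Suc n. ?\<alpha> m * \<gamma> m) + \<beta> \<bullet> z" for \<gamma> z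
  proof -
    have "v \<bullet> walk f i \<gamma> z (Suc n) = (v - (?f \<bullet> v) *\<^sub>R ?f) \<bullet> walk f i \<gamma> z n + (?f \<bullet> v) * \<gamma> n"
      by (simp add: inner_add_right inner_diff_left inner_commute algebra_simps)
    then show ?thesis unfolding walk by simp
  qed
  moreover have "(\<Sum>m<Suc n. (?\<alpha> m)\<^sup>2) + (norm \<beta>)\<^sup>2 = (norm v)\<^sup>2"
    using nrm norm_project_out[OF f, of v "i n"] by simp
  ultimately show ?case by blast
qed

lemma measurable_walk:
  fixes f :: "'n::finite \<Rightarrow> real^'n"
  assumes i[measurable]: "\<And>n. (\<lambda>x. i x n) \<in> measurable N (count_space UNIV)"
    and [measurable]: "\<And>n. (\<lambda>x. \<gamma> x n) \<in> borel_measurable N" "z \<in> borel_measurable N"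
  shows "(\<lambda>x. walk f (i x) (\<gamma> x) (z x) n) \<in> borel_measurable N"
proof (induction n)
  case (Suc n)
  note [measurable] = Suc
  have [measurable]: "(\<lambda>x. f (i x n)) \<in> borel_measurable N"
    by (rule measurable_compose[OF i]) simp
  show ?case by simp
qed simp

section \<open>The recursions of the theorem expressed as walks\<close>

context
  fixes V :: "real^'n^'n"
  assumes V_pd: "pd_mat V" and V_diag: "\<forall>k. V $ k $ k = 1"
begin

text \<open>The unit diagonal enters here, through f_k . f_k = V_kk; it makes each
  \<open>Pmat V k\<close> an orthogonal projection.\<close>

lemma norm_fvec: "norm (fvec V k) = 1"
proof -
  note S = mat_sqrt_pd[OF V_pd]
  have "fvec V k \<bullet> fvec V k = axis k 1 \<bullet> (mat_sqrt V *v (mat_sqrt V *v axis k 1))"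
    unfolding fvec_def using symmetric_inner_matrix_vector[OF S(1)] by simp
  also have "\<dots> = 1"
    unfolding matrix_vector_mul_assoc S(2)
    using V_diag by (simp add: inner_axis' matrix_vector_mult_basis column_def)
  finally show ?thesis by (simp add: norm_eq_1)
qed

lemma Pmat_mult: "Pmat V k *v x = x - (fvec V k \<bullet> x) *\<^sub>R fvec V k"
proof -
  have "outer u v *v x = (v \<bullet> x) *\<^sub>R u" for u v :: "real^'n"
    by (simp add: outer_def matrix_vector_mult_def vec_eq_iff inner_vec_def sum_distrib_left mult_ac)
  then show ?thesis by (simp add: Pmat_def matrix_vector_mult_diff_rdistrib)
qed

lemma Yseq_eq_walk: "Yseq V I g n \<omega> = walk (fvec V) (\<lambda>n. I n \<omega>) (\<lambda>n. g n \<omega>) 0 n"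
  by (induction n) (auto simp: Pmat_mult algebra_simps)

lemma Mseq_eq_walk: "Mseq V I n \<omega> *v z = walk (fvec V) (\<lambda>n. I n \<omega>) (\<lambda>_. 0) z n"
  by (induction n) (auto simp: Pmat_mult simp flip: matrix_vector_mul_assoc)

lemma Zseq_eq_walk: "Zseq V I g Z0 n \<omega> = walk (fvec V) (\<lambda>n. I n \<omega>) (\<lambda>n. g n \<omega>) (Z0 \<omega>) n"
  unfolding Zseq_def Yseq_eq_walk Mseq_eq_walk by (rule walk_superposition[symmetric])

text \<open>The coordinate of S y read by a step of X is f_k . y, because S is symmetric, and the
  direction V e_k is S f_k. So S intertwines the two recursions.\<close>

lemma Xseq_eq_walk:
  "Xseq V I g n \<omega> = mat_sqrt V *v walk (fvec V) (\<lambda>n. I n \<omega>) (\<lambda>n. g n \<omega>) 0 n"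
proof (induction n)
  case (Suc n)
  note S = mat_sqrt_pd[OF V_pd]
  have "(mat_sqrt V *v x) $ k = fvec V k \<bullet> x" for x k
  proof -
    have "(mat_sqrt V *v x) $ k = axis k 1 \<bullet> (mat_sqrt V *v x)" by (simp add: inner_axis')
    then show ?thesis by (simp add: symmetric_inner_matrix_vector[OF S(1)] fvec_def)
  qed
  moreover have "V *v axis k 1 = mat_sqrt V *v fvec V k" for k
    by (simp add: fvec_def matrix_vector_mul_assoc S(2))
  ultimately show ?case
    by (simp add: Suc matrix_vector_right_distrib matrix_vector_mult_scaleR)
qed simp

lemma fvec_average_contraction:
  obtains \<rho> where "0 < \<rho>" "\<rho> < 1"
    "\<And>z. (\<Sum>k\<in>UNIV. (norm (z - (fvec V k \<bullet> z) *\<^sub>R fvec V k))\<^sup>2) / CARD('n) \<le> \<rho> * (norm z)\<^sup>2"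
proof -
  note S = mat_sqrt_pd[OF V_pd]
  obtain l where l: "l > 0" "\<And>x. l * (norm x)\<^sup>2 \<le> x \<bullet> (V *v x)"
    using pd_mat_lower_bound[OF V_pd] by blast
  let ?d = "real CARD('n)"
  \<comment> \<open>The loss averaged over the index is z . V z / d, hence 1 - l / d. The maximum
    keeps \<rho> positive, since \<rho>^j is later a divisor and a base of real powers; for d = 1
    the other entry can be 0.\<close>
  define \<rho> where "\<rho> = max (1/2) (1 - l / ?d)"
  show thesis
  proof
    show "0 < \<rho>" "\<rho> < 1" using l(1) by (auto simp: \<rho>_def)
    fix z
    have "(\<Sum>k\<in>UNIV. (fvec V k \<bullet> z)\<^sup>2) = (norm (mat_sqrt V *v z))\<^sup>2"
    proof -
      have "fvec V k \<bullet> z = (mat_sqrt V *v z) $ k" for k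
        using symmetric_inner_matrix_vector[OF S(1), of "axis k 1" z] by (simp add: fvec_def inner_axis')
      then show ?thesis by (simp add: norm_vec_def L2_set_def sum_nonneg)
    qed
    also have "\<dots> = z \<bullet> (V *v z)"
      using symmetric_inner_matrix_vector[OF S(1), of z "mat_sqrt V *v z"]
      by (simp add: power2_norm_eq_inner matrix_vector_mul_assoc S(2))
    finally have "l * (norm z)\<^sup>2 \<le> (\<Sum>k\<in>UNIV. (fvec V k \<bullet> z)\<^sup>2)" using l(2)[of z] by simp
    then have "(\<Sum>k\<in>UNIV. (norm (z - (fvec V k \<bullet> z) *\<^sub>R fvec V k))\<^sup>2) \<le> ?d * (norm z)\<^sup>2 - l * (norm z)\<^sup>2"
      by (simp add: norm_project_out[OF norm_fvec] sum_subtractf)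
    also have "\<dots> = ?d * ((1 - l / ?d) * (norm z)\<^sup>2)" by (simp add: field_simps)
    also have "\<dots> \<le> ?d * (\<rho> * (norm z)\<^sup>2)"
      by (intro mult_left_mono mult_right_mono) (auto simp: \<rho>_def)
    finally show "(\<Sum>k\<in>UNIV. (norm (z - (fvec V k \<bullet> z) *\<^sub>R fvec V k))\<^sup>2) / ?d \<le> \<rho> * (norm z)\<^sup>2"
      by (simp add: divide_le_eq mult.commute)
  qed
qed

end

section \<open>The stationary chain\<close>

lemma measurable_PiM_Suc:
  "(\<lambda>w n. w (Suc n)) \<in> (\<Pi>\<^sub>M n\<in>(UNIV::nat set). N) \<rightarrow>\<^sub>M (\<Pi>\<^sub>M n\<in>UNIV. N)"
  by (rule measurable_PiM_single') (auto simp: space_PiM)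

text \<open>An i.i.d. sequence is its first term followed by an independent copy of itself. Applied
  to indices and noise, this reduces conditioning on the first step to an iterated integral.\<close>

lemma nn_integral_PiM_iter:
  assumes "prob_space N" and [measurable]: "F \<in> borel_measurable (N \<Otimes>\<^sub>M (\<Pi>\<^sub>M n\<in>UNIV. N))"
  shows "(\<integral>\<^sup>+w. F (w 0, \<lambda>n. w (Suc n)) \<partial>(\<Pi>\<^sub>M n\<in>(UNIV::nat set). N))
    = (\<integral>\<^sup>+x. \<integral>\<^sup>+w. F (x, w) \<partial>(\<Pi>\<^sub>M n\<in>UNIV. N) \<partial>N)"
proof -
  interpret N: prob_space N by fact
  interpret S: prob_space "\<Pi>\<^sub>M n\<in>(UNIV::nat set). N" by (rule prob_space_PiM) (rule assms(1))
  interpret sequence_space N ..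
  note [measurable] = measurable_PiM_Suc[of N]
  have "(\<integral>\<^sup>+w. F (w 0, \<lambda>n. w (Suc n)) \<partial>S)
      = (\<integral>\<^sup>+w. F (w 0, \<lambda>n. w (Suc n)) \<partial>distr (N \<Otimes>\<^sub>M S) S (\<lambda>(s, \<omega>). case_nat s \<omega>))"
    by (simp only: PiM_iter)
  also have "\<dots> = (\<integral>\<^sup>+x. F x \<partial>(N \<Otimes>\<^sub>M S))"
    by (subst nn_integral_distr) (auto simp: case_prod_beta)
  also have "\<dots> = (\<integral>\<^sup>+x. \<integral>\<^sup>+w. F (x, w) \<partial>S \<partial>N)"
    by (simp add: S.nn_integral_fst[symmetric])
  finally show ?thesis .
qed

abbreviation uniform_index :: "'n::finite measure" where
  "uniform_index \<equiv> measure_pmf (pmf_of_set UNIV)"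

abbreviation index_law :: "(nat \<Rightarrow> 'n::finite) measure" where
  "index_law \<equiv> (\<Pi>\<^sub>M n\<in>UNIV. uniform_index)"

abbreviation noise_law :: "(nat \<Rightarrow> real) measure" where
  "noise_law \<equiv> (\<Pi>\<^sub>M n\<in>UNIV. std_normal_distribution)"

text \<open>The canonical space of indices, noise and start. Statements about laws are proved here
  and carried to the given probability space by \<open>law_chain\<close>.\<close>

definition chain_law :: "((nat \<Rightarrow> 'n::finite) \<times> (nat \<Rightarrow> real) \<times> (real^'n)) measure" where
  "chain_law = index_law \<Otimes>\<^sub>M (noise_law \<Otimes>\<^sub>M std_gauss)"

text \<open>The shift performs one step and forgets the index and the noise it used, so invariance of
  \<open>chain_law\<close> under the shift is stationarity of the walk.\<close>

definition chain_shift ::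
  "('n \<Rightarrow> real^'n) \<Rightarrow> (nat \<Rightarrow> 'n) \<times> (nat \<Rightarrow> real) \<times> (real^'n) \<Rightarrow> (nat \<Rightarrow> 'n) \<times> (nat \<Rightarrow> real) \<times> (real^'n)" where
  "chain_shift f = (\<lambda>(i, \<gamma>, z).
     (\<lambda>n. i (Suc n), \<lambda>n. \<gamma> (Suc n), z + (\<gamma> 0 - f (i 0) \<bullet> z) *\<^sub>R f (i 0)))"

lemma prob_space_std_normal: "prob_space std_normal_distribution"
  by (rule prob_space_normal_density) simp

lemma prob_space_noise_law: "prob_space noise_law"
  by (intro prob_space_PiM prob_space_std_normal)

lemma prob_space_index_law: "prob_space index_law"
  by (intro prob_space_PiM prob_space_measure_pmf)

lemma nn_integral_uniform_index:
  "(\<integral>\<^sup>+k. ennreal (F k) \<partial>(uniform_index :: 'n::finite measure)) = ennreal ((\<Sum>k\<in>UNIV. F k) / CARD('n))"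
  if "\<And>k. 0 \<le> F k"
  using that divide_ennreal[of "sum F UNIV" "real CARD('n)"]
  by (simp add: nn_integral_pmf_of_set sum_nonneg ennreal_of_nat_eq_real_of_nat)

lemma measurable_index_component [measurable]:
  "(\<lambda>i. i n) \<in> index_law \<rightarrow>\<^sub>M count_space UNIV"
  using measurable_component_singleton[of n UNIV "\<lambda>_. uniform_index"]
  by (simp cong: measurable_cong_sets)

text \<open>The first index moves z to a projected point, and what follows is a walk with fresh
  indices from there. So the induction must cover all starts; averaging over the first index then
  gains one factor \<rho>.\<close>

lemma nn_integral_norm_walk_le:
  fixes f :: "'n::finite \<Rightarrow> real^'n"
  assumes contr: "\<And>z. (\<Sum>k\<in>UNIV. (norm (z - (f k \<bullet> z) *\<^sub>R f k))\<^sup>2) / CARD('n) \<le> \<rho> * (norm z)\<^sup>2"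
    and "0 \<le> \<rho>"
  shows "(\<integral>\<^sup>+i. ennreal ((norm (walk f i (\<lambda>_. 0) z n))\<^sup>2) \<partial>index_law) \<le> ennreal (\<rho> ^ n * (norm z)\<^sup>2)"
proof (induction n arbitrary: z)
  case 0
  interpret U: prob_space "index_law :: (nat \<Rightarrow> 'n) measure" by (rule prob_space_index_law)
  show ?case by (simp add: U.emeasure_space_1)
next
  case (Suc n)
  interpret U: prob_space index_law by (rule prob_space_index_law)
  let ?F = "\<lambda>(k, i). ennreal ((norm (walk f i (\<lambda>_. 0) (z - (f k \<bullet> z) *\<^sub>R f k) n))\<^sup>2)"
  have [measurable]: "f \<in> borel_measurable uniform_index" by (simp cong: measurable_cong_sets)
  have [measurable]: "(\<lambda>x. walk f (snd x) (\<lambda>_. 0) (z - (f (fst x) \<bullet> z) *\<^sub>R f (fst x)) n)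
      \<in> borel_measurable (uniform_index \<Otimes>\<^sub>M index_law)"
    by (rule measurable_walk) simp_all
  have "(\<integral>\<^sup>+i. ennreal ((norm (walk f i (\<lambda>_. 0) z (Suc n)))\<^sup>2) \<partial>index_law)
      = (\<integral>\<^sup>+i. ?F (i 0, \<lambda>n. i (Suc n)) \<partial>index_law)"
    by (simp add: walk_Suc_shift del: walk.simps)
  also have "\<dots> = (\<integral>\<^sup>+k. \<integral>\<^sup>+i. ?F (k, i) \<partial>index_law \<partial>uniform_index)"
    by (rule nn_integral_PiM_iter) (auto simp: case_prod_beta intro: prob_space_measure_pmf)
  also have "\<dots> \<le> (\<integral>\<^sup>+k. ennreal (\<rho> ^ n * (norm (z - (f k \<bullet> z) *\<^sub>R f k))\<^sup>2) \<partial>uniform_index)"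
    by (rule nn_integral_mono) (simp add: Suc)
  also have "\<dots> = ennreal (\<rho> ^ n * ((\<Sum>k\<in>UNIV. (norm (z - (f k \<bullet> z) *\<^sub>R f k))\<^sup>2) / CARD('n)))"
    by (subst nn_integral_uniform_index) (auto simp: \<open>0 \<le> \<rho>\<close> sum_distrib_left)
  also have "\<dots> \<le> ennreal (\<rho> ^ n * (\<rho> * (norm z)\<^sup>2))"
    using contr \<open>0 \<le> \<rho>\<close> by (intro ennreal_leI mult_left_mono) auto
  finally show ?case by (simp add: mult_ac)
qed

lemma measurable_chain_shift [measurable]:
  fixes f :: "'n::finite \<Rightarrow> real^'n"
  shows "chain_shift f \<in> chain_law \<rightarrow>\<^sub>M chain_law"
proof -
  have [measurable]: "f \<in> borel_measurable (count_space UNIV)" by simp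
  note [measurable] = measurable_PiM_Suc[of "uniform_index :: 'n measure"]
    measurable_PiM_Suc[of std_normal_distribution]
  show ?thesis unfolding chain_shift_def chain_law_def case_prod_beta by measurable
qed

text \<open>For a fixed first index, integrating over the first noise and the start resamples one
  component of a standard Gaussian vector, which leaves its law unchanged. The result does not
  depend on that index, which therefore integrates out.\<close>

lemma nn_integral_chain_shift:
  fixes f :: "'n::finite \<Rightarrow> real^'n"
  assumes f: "\<And>k. norm (f k) = 1" and F[measurable]: "F \<in> borel_measurable chain_law"
  shows "(\<integral>\<^sup>+x. F (chain_shift f x) \<partial>chain_law) = (\<integral>\<^sup>+x. F x \<partial>chain_law)"
proof -
  interpret I: prob_space "index_law :: (nat \<Rightarrow> 'n) measure" by (rule prob_space_index_law)
  interpret N: prob_space noise_law by (rule prob_space_noise_law)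
  interpret s: prob_space std_normal_distribution by (rule prob_space_std_normal)
  interpret G: prob_space "std_gauss :: (real^'n) measure" by (rule prob_space_std_gauss)
  interpret NG: pair_prob_space noise_law "std_gauss :: (real^'n) measure" ..
  interpret sNG: pair_prob_space std_normal_distribution "noise_law \<Otimes>\<^sub>M (std_gauss :: (real^'n) measure)" ..
  have [measurable]: "f \<in> borel_measurable (count_space UNIV)" "f \<in> borel_measurable uniform_index" by simp_all
  have F'[measurable]: "F \<in> borel_measurable (index_law \<Otimes>\<^sub>M (noise_law \<Otimes>\<^sub>M std_gauss))"
    using F by (simp add: chain_law_def)
  note [measurable] = measurable_PiM_Suc[of "uniform_index :: 'n measure"]
    measurable_PiM_Suc[of std_normal_distribution]
  have inner: "(\<integral>\<^sup>+\<gamma>. \<integral>\<^sup>+z. F (i, \<lambda>n. \<gamma> (Suc n), z + (\<gamma> 0 - f k \<bullet> z) *\<^sub>R f k) \<partial>std_gauss \<partial>noise_law)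
      = (\<integral>\<^sup>+y. F (i, y) \<partial>(noise_law \<Otimes>\<^sub>M std_gauss))" if i: "i \<in> space index_law" for i k
  proof -
    have [measurable]: "(\<lambda>y. F (i, y)) \<in> borel_measurable (noise_law \<Otimes>\<^sub>M std_gauss)"
      using i by measurable
    have "(\<integral>\<^sup>+\<gamma>. \<integral>\<^sup>+z. F (i, \<lambda>n. \<gamma> (Suc n), z + (\<gamma> 0 - f k \<bullet> z) *\<^sub>R f k) \<partial>std_gauss \<partial>noise_law)
        = (\<integral>\<^sup>+t. \<integral>\<^sup>+\<gamma>. \<integral>\<^sup>+z. F (i, \<gamma>, z + (t - f k \<bullet> z) *\<^sub>R f k) \<partial>std_gauss \<partial>noise_law \<partial>std_normal_distribution)"
      using nn_integral_PiM_iter[OF prob_space_std_normal,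
          of "\<lambda>(t, \<gamma>). \<integral>\<^sup>+z. F (i, \<gamma>, z + (t - f k \<bullet> z) *\<^sub>R f k) \<partial>std_gauss"] by simp
    also have "\<dots> = (\<integral>\<^sup>+t. \<integral>\<^sup>+y. F (i, fst y, snd y + (t - f k \<bullet> snd y) *\<^sub>R f k) \<partial>(noise_law \<Otimes>\<^sub>M std_gauss) \<partial>std_normal_distribution)"
      by (simp add: G.nn_integral_fst[symmetric])
    also have "\<dots> = (\<integral>\<^sup>+y. \<integral>\<^sup>+t. F (i, fst y, snd y + (t - f k \<bullet> snd y) *\<^sub>R f k) \<partial>std_normal_distribution \<partial>(noise_law \<Otimes>\<^sub>M std_gauss))"
      by (rule sNG.Fubini'[symmetric]) measurable
    also have "\<dots> = (\<integral>\<^sup>+\<gamma>. \<integral>\<^sup>+z. \<integral>\<^sup>+t. F (i, \<gamma>, z + (t - f k \<bullet> z) *\<^sub>R f k) \<partial>std_normal_distribution \<partial>std_gauss \<partial>noise_law)"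
      by (simp add: G.nn_integral_fst[symmetric])
    also have "\<dots> = (\<integral>\<^sup>+\<gamma>. \<integral>\<^sup>+z. F (i, \<gamma>, z) \<partial>std_gauss \<partial>noise_law)"
    proof (rule nn_integral_cong)
      fix \<gamma> assume \<gamma>: "\<gamma> \<in> space noise_law"
      have "(\<lambda>z. F (i, \<gamma>, z)) \<in> borel_measurable std_gauss" using \<gamma> by measurable
      then have "(\<lambda>z. F (i, \<gamma>, z)) \<in> borel_measurable borel" by (simp cong: measurable_cong_sets)
      from nn_integral_std_gauss_resample[OF f this]
      show "(\<integral>\<^sup>+z. \<integral>\<^sup>+t. F (i, \<gamma>, z + (t - f k \<bullet> z) *\<^sub>R f k) \<partial>std_normal_distribution \<partial>std_gauss)
          = (\<integral>\<^sup>+z. F (i, \<gamma>, z) \<partial>std_gauss)" .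
    qed
    also have "\<dots> = (\<integral>\<^sup>+y. F (i, y) \<partial>(noise_law \<Otimes>\<^sub>M std_gauss))"
      by (simp add: G.nn_integral_fst[symmetric])
    finally show ?thesis .
  qed
  have "(\<integral>\<^sup>+x. F (chain_shift f x) \<partial>chain_law)
      = (\<integral>\<^sup>+i. \<integral>\<^sup>+\<gamma>. \<integral>\<^sup>+z. F (\<lambda>n. i (Suc n), \<lambda>n. \<gamma> (Suc n), z + (\<gamma> 0 - f (i 0) \<bullet> z) *\<^sub>R f (i 0))
          \<partial>std_gauss \<partial>noise_law \<partial>index_law)"
  proof -
    have [measurable]: "(\<lambda>x. F (chain_shift f x)) \<in> borel_measurable (index_law \<Otimes>\<^sub>M (noise_law \<Otimes>\<^sub>M std_gauss))"
      using measurable_compose[OF measurable_chain_shift F, of f] by (simp add: chain_law_def)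
    have "(\<integral>\<^sup>+y. F (chain_shift f (i, y)) \<partial>(noise_law \<Otimes>\<^sub>M std_gauss))
        = (\<integral>\<^sup>+\<gamma>. \<integral>\<^sup>+z. F (chain_shift f (i, \<gamma>, z)) \<partial>std_gauss \<partial>noise_law)" if "i \<in> space index_law" for i
    proof -
      have "(\<lambda>y. F (chain_shift f (i, y))) \<in> borel_measurable (noise_law \<Otimes>\<^sub>M std_gauss)"
        using that by measurable
      from G.nn_integral_fst[OF this] show ?thesis by simp
    qed
    then have "(\<integral>\<^sup>+i. \<integral>\<^sup>+y. F (chain_shift f (i, y)) \<partial>(noise_law \<Otimes>\<^sub>M std_gauss) \<partial>index_law)
        = (\<integral>\<^sup>+i. \<integral>\<^sup>+\<gamma>. \<integral>\<^sup>+z. F (chain_shift f (i, \<gamma>, z)) \<partial>std_gauss \<partial>noise_law \<partial>index_law)"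
      by (intro nn_integral_cong)
    then show ?thesis
      unfolding chain_law_def by (simp add: NG.nn_integral_fst[symmetric]) (simp add: chain_shift_def)
  qed
  also have "\<dots> = (\<integral>\<^sup>+k. \<integral>\<^sup>+i. \<integral>\<^sup>+\<gamma>. \<integral>\<^sup>+z. F (i, \<lambda>n. \<gamma> (Suc n), z + (\<gamma> 0 - f k \<bullet> z) *\<^sub>R f k)
          \<partial>std_gauss \<partial>noise_law \<partial>index_law \<partial>uniform_index)"
    using nn_integral_PiM_iter[OF prob_space_measure_pmf, of "\<lambda>(k, i). \<integral>\<^sup>+\<gamma>. \<integral>\<^sup>+z.
        F (i, \<lambda>n. \<gamma> (Suc n), z + (\<gamma> 0 - f k \<bullet> z) *\<^sub>R f k) \<partial>std_gauss \<partial>noise_law" "pmf_of_set UNIV"] by simp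
  also have "\<dots> = (\<integral>\<^sup>+k. \<integral>\<^sup>+i. \<integral>\<^sup>+y. F (i, y) \<partial>(noise_law \<Otimes>\<^sub>M std_gauss) \<partial>index_law \<partial>(uniform_index :: 'n measure))"
    by (intro nn_integral_cong inner)
  also have "\<dots> = (\<integral>\<^sup>+x. F x \<partial>chain_law)"
    unfolding chain_law_def by (simp add: NG.nn_integral_fst measure_pmf.emeasure_space_1)
  finally show ?thesis .
qed

lemma distr_chain_shift:
  fixes f :: "'n::finite \<Rightarrow> real^'n"
  assumes f: "\<And>k. norm (f k) = 1"
  shows "distr chain_law chain_law (chain_shift f) = chain_law"
proof (rule measure_eqI)
  fix A assume "A \<in> sets (distr chain_law chain_law (chain_shift f))"
  then have [measurable]: "A \<in> sets chain_law" by simp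
  have "emeasure (distr chain_law chain_law (chain_shift f)) A
      = (\<integral>\<^sup>+x. indicator A x \<partial>distr chain_law chain_law (chain_shift f))" by simp
  also have "\<dots> = (\<integral>\<^sup>+x. indicator A (chain_shift f x) \<partial>chain_law)"
    by (rule nn_integral_distr) measurable
  also have "\<dots> = emeasure chain_law A"
    by (subst nn_integral_chain_shift[OF f]) auto
  finally show "emeasure (distr chain_law chain_law (chain_shift f)) A = emeasure chain_law A" .
qed simp

definition chain_path :: "('n \<Rightarrow> real^'n) \<Rightarrow> nat \<Rightarrow> (nat \<Rightarrow> 'n) \<times> (nat \<Rightarrow> real) \<times> (real^'n) \<Rightarrow> real^'n" where
  "chain_path f n = (\<lambda>(i, \<gamma>, z). walk f i \<gamma> z n)"

lemma measurable_chain_path [measurable]: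
  fixes f :: "'n::finite \<Rightarrow> real^'n"
  shows "chain_path f n \<in> borel_measurable chain_law"
  unfolding chain_path_def chain_law_def case_prod_beta
  by (rule measurable_walk) measurable

text \<open>Shifting the space by one step moves both times by one, and the shift preserves the law.
  Pairs are needed rather than single times because covariances are to be compared.\<close>

lemma distr_chain_path_pair:
  fixes f :: "'n::finite \<Rightarrow> real^'n"
  assumes f: "\<And>k. norm (f k) = 1"
  shows "distr chain_law borel (\<lambda>x. (chain_path f j x, chain_path f (j + k) x))
    = distr chain_law borel (\<lambda>x. (chain_path f 0 x, chain_path f k x))"
proof (induction j)
  case (Suc j)
  have path: "chain_path f (Suc n) x = chain_path f n (chain_shift f x)" for n x
    by (simp add: chain_path_def chain_shift_def walk_Suc_shift case_prod_beta del: walk.simps)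
  have "distr chain_law borel (\<lambda>x. (chain_path f (Suc j) x, chain_path f (Suc j + k) x))
      = distr (distr chain_law chain_law (chain_shift f)) borel (\<lambda>x. (chain_path f j x, chain_path f (j + k) x))"
    by (subst distr_distr) (auto simp: comp_def path simp flip: borel_prod)
  then show ?case by (simp add: distr_chain_shift[OF f] Suc)
qed simp

section \<open>Comparison of the two chains\<close>

text \<open>Takes the place of Jensen's inequality: the concave power is bounded by an affine
  function of q, below t by the constant and above t by the slope. Integrated with t of the order of
  the mean of q, it loses only a constant factor.\<close>

lemma powr_le_rescaled:
  fixes q t \<gamma> :: real
  assumes "0 \<le> q" "0 < t" "0 < \<gamma>" "\<gamma> \<le> 1"
  shows "q powr \<gamma> \<le> t powr \<gamma> * (1 + q / t)"
proof (cases "q \<le> t")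
  case True
  have "q powr \<gamma> \<le> t powr \<gamma> * 1" using True assms by (simp add: powr_mono2)
  also have "\<dots> \<le> t powr \<gamma> * (1 + q / t)" using assms by (intro mult_left_mono) auto
  finally show ?thesis .
next
  case False
  have "q powr \<gamma> = t powr \<gamma> * (q / t) powr \<gamma>"
    using assms by (simp add: powr_divide)
  also have "\<dots> \<le> t powr \<gamma> * (q / t) powr 1"
    using False assms by (intro mult_left_mono powr_mono) auto
  also have "\<dots> \<le> t powr \<gamma> * (1 + q / t)" using assms by (intro mult_left_mono) auto
  finally show ?thesis .
qed

lemma measurable_matrix_vector_mult [measurable]:
  fixes A :: "real^'n^'m"
  assumes [measurable]: "F \<in> borel_measurable N"
  shows "(\<lambda>x. A *v F x) \<in> borel_measurable N"
  by (rule measurable_compose[OF assms])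
    (intro borel_measurable_continuous_onI linear_continuous_on matrix_vector_mul_bounded_linear)

text \<open>Groups indices with noise against the start, the form needed to show that anything built
  from the former is independent of Z_0.\<close>

lemma distr_chain_law_assoc:
  "distr chain_law ((index_law \<Otimes>\<^sub>M noise_law) \<Otimes>\<^sub>M std_gauss) (\<lambda>(i, \<gamma>, z). ((i, \<gamma>), z))
    = (index_law \<Otimes>\<^sub>M noise_law) \<Otimes>\<^sub>M (std_gauss :: (real^'n) measure)"
proof (rule sym, rule pair_measure_eqI)
  interpret N: prob_space noise_law by (rule prob_space_noise_law)
  interpret G: prob_space "std_gauss :: (real^'n) measure" by (rule prob_space_std_gauss)
  interpret NG: pair_prob_space noise_law "std_gauss :: (real^'n) measure" ..
  let ?IN = "(index_law :: (nat \<Rightarrow> 'n) measure) \<Otimes>\<^sub>M noise_law"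
  let ?assoc = "\<lambda>(i :: nat \<Rightarrow> 'n, \<gamma> :: nat \<Rightarrow> real, z :: real^'n). ((i, \<gamma>), z)"
  show "sigma_finite_measure ?IN" "sigma_finite_measure (std_gauss :: (real^'n) measure)"
    by (intro prob_space_imp_sigma_finite prob_space_pair prob_space_index_law prob_space_noise_law
        prob_space_std_gauss)+
  fix A B assume A[measurable]: "A \<in> sets ?IN" and B[measurable]: "B \<in> sets (std_gauss :: (real^'n) measure)"
  have [measurable]: "?assoc \<in> chain_law \<rightarrow>\<^sub>M ?IN \<Otimes>\<^sub>M std_gauss"
    unfolding chain_law_def case_prod_beta by measurable
  have "emeasure (distr chain_law (?IN \<Otimes>\<^sub>M std_gauss) ?assoc) (A \<times> B)
      = (\<integral>\<^sup>+x. indicator (A \<times> B) x \<partial>distr chain_law (?IN \<Otimes>\<^sub>M std_gauss) ?assoc)"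
    by (rule nn_integral_indicator[symmetric]) (simp only: sets_distr, rule pair_measureI; fact)
  also have "\<dots> = (\<integral>\<^sup>+x. indicator (A \<times> B) (?assoc x) \<partial>chain_law)"
    by (rule nn_integral_distr) measurable
  also have "\<dots> = (\<integral>\<^sup>+x. indicator A (fst x, fst (snd x)) * indicator B (snd (snd x)) \<partial>chain_law)"
    by (auto intro!: nn_integral_cong simp: indicator_def)
  also have "\<dots> = (\<integral>\<^sup>+i. \<integral>\<^sup>+\<gamma>. \<integral>\<^sup>+z. indicator A (i, \<gamma>) * indicator B z \<partial>std_gauss \<partial>noise_law \<partial>index_law)"
  proof -
    have "(\<integral>\<^sup>+y. indicator A (i, fst y) * indicator B (snd y) \<partial>(noise_law \<Otimes>\<^sub>M std_gauss))
        = (\<integral>\<^sup>+\<gamma>. \<integral>\<^sup>+z. indicator A (i, \<gamma>) * indicator B z \<partial>std_gauss \<partial>noise_law :: ennreal)"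
      if "i \<in> space index_law" for i
    proof -
      have "(\<lambda>y. indicator A (i, fst y) * indicator B (snd y) :: ennreal)
          \<in> borel_measurable (noise_law \<Otimes>\<^sub>M std_gauss)"
        using that by measurable
      from G.nn_integral_fst[OF this] show ?thesis by simp
    qed
    then show ?thesis
      unfolding chain_law_def by (subst NG.nn_integral_fst[symmetric]) (auto intro!: nn_integral_cong)
  qed
  also have "\<dots> = (\<integral>\<^sup>+i. \<integral>\<^sup>+\<gamma>. indicator A (i, \<gamma>) * emeasure std_gauss B \<partial>noise_law \<partial>index_law)"
    using nn_integral_indicator[OF B] by (simp add: nn_integral_cmult)
  also have "\<dots> = (\<integral>\<^sup>+x. indicator A x * emeasure std_gauss B \<partial>?IN)"
    by (simp add: N.nn_integral_fst[symmetric])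
  also have "\<dots> = emeasure ?IN A * emeasure std_gauss B"
    by (simp add: nn_integral_multc)
  finally show "emeasure ?IN A * emeasure std_gauss B
      = emeasure (distr chain_law (?IN \<Otimes>\<^sub>M std_gauss) ?assoc) (A \<times> B)" ..
qed simp

section \<open>The given probability space and the law of its chain\<close>

locale gaussian_chain = prob_space M for M :: "'a measure" +
  fixes V :: "real^'n^'n"
    and I :: "nat \<Rightarrow> 'a \<Rightarrow> 'n"
    and g :: "nat \<Rightarrow> 'a \<Rightarrow> real"
    and Zc :: "'n \<Rightarrow> 'a \<Rightarrow> real"
  assumes V_pd: "pd_mat V" and V_diag: "\<forall>i. V $ i $ i = 1"
    and I_meas: "\<forall>n. I n \<in> measurable M (count_space UNIV)"
    and I_unif: "\<forall>n k. measure M {\<omega> \<in> space M. I n \<omega> = k} = 1 / real CARD('n)"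
    and I_indep: "indep_vars (\<lambda>_. count_space UNIV) I UNIV"
    and G_meas: "\<forall>j. case_sum g Zc j \<in> borel_measurable M"
    and G_normal: "\<forall>j. distr M borel (case_sum g Zc j) = std_normal_distribution"
    and G_indep: "indep_vars (\<lambda>_. borel) (case_sum g Zc) UNIV"
    and IG_indep: "indep_set
        (sets (vimage_algebra (space M) (\<lambda>\<omega> n. I n \<omega>) (PiM UNIV (\<lambda>_. count_space UNIV))))
        (sets (vimage_algebra (space M) (\<lambda>\<omega> j. case_sum g Zc j \<omega>) (PiM UNIV (\<lambda>_. borel))))"
begin

abbreviation Z0 :: "'a \<Rightarrow> real^'n" where "Z0 \<omega> \<equiv> (\<chi> k. Zc k \<omega>)"

abbreviation f :: "'n \<Rightarrow> real^'n" where "f \<equiv> fvec V"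

abbreviation S :: "real^'n^'n" where "S \<equiv> mat_sqrt V"

lemma measurable_g [measurable]: "g n \<in> borel_measurable M"
  using G_meas[rule_format, of "Inl n"] by simp

lemma measurable_Zc [measurable]: "Zc k \<in> borel_measurable M"
  using G_meas[rule_format, of "Inr k"] by simp

lemma measurable_Z0 [measurable]: "Z0 \<in> borel_measurable M"
  by (rule borel_measurable_vecI) simp

lemma measurable_I [measurable]: "I n \<in> measurable M (count_space UNIV)"
  using I_meas by simp

lemma law_G: "distr M (\<Pi>\<^sub>M j\<in>UNIV. borel) (\<lambda>\<omega> j. case_sum g Zc j \<omega>) = (\<Pi>\<^sub>M j\<in>UNIV. std_normal_distribution)"
  using indep_vars_iff_distr_eq_PiM[where I=UNIV and M'="\<lambda>_. borel" and X="case_sum g Zc"] G_indep G_meas G_normal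
  by (simp add: restrict_UNIV)

text \<open>Noise and start are the \<open>Inl\<close> and \<open>Inr\<close> blocks of one
  independent family, so the blocks are independent of each other. Reindexing gives the law of each
  block, and \<open>vec_lambda\<close> turns the second into \<open>std_gauss\<close>.\<close>

lemma law_noise: "distr M (noise_law \<Otimes>\<^sub>M std_gauss) (\<lambda>\<omega>. (\<lambda>n. g n \<omega>, Z0 \<omega>)) = noise_law \<Otimes>\<^sub>M std_gauss"
proof -
  let ?P = "\<Pi>\<^sub>M j\<in>(UNIV :: (nat + 'n) set). std_normal_distribution"
  have [measurable]: "(\<lambda>\<omega> j. case_sum g Zc j \<omega>) \<in> M \<rightarrow>\<^sub>M (\<Pi>\<^sub>M j\<in>UNIV. borel)"
    using G_meas by (intro measurable_PiM_single') (auto simp: space_PiM)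
  have Y1: "(\<lambda>w n. w (Inl n)) \<in> PiM J (\<lambda>_. borel) \<rightarrow>\<^sub>M noise_law" if "range Inl \<subseteq> J" for J :: "(nat + 'n) set"
    by (rule measurable_PiM_single')
      (use that in \<open>auto simp: space_PiM intro!: measurable_component_singleton\<close>)
  have Y2: "(\<lambda>w. \<chi> k. w (Inr k)) \<in> PiM J (\<lambda>_. borel) \<rightarrow>\<^sub>M (borel :: (real^'n) measure)"
    if "range Inr \<subseteq> J" for J :: "(nat + 'n) set"
    by (rule borel_measurable_vecI)
      (use that in \<open>auto intro!: measurable_component_singleton\<close>)
  have sP: "sets ?P = sets (PiM UNIV (\<lambda>_. borel))" by (rule sets_PiM_cong) auto
  have g_law: "distr M noise_law (\<lambda>\<omega> n. g n \<omega>) = noise_law"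
  proof -
    have "distr M noise_law (\<lambda>\<omega> n. g n \<omega>)
        = distr (distr M (\<Pi>\<^sub>M j\<in>UNIV. borel) (\<lambda>\<omega> j. case_sum g Zc j \<omega>)) noise_law (\<lambda>w n. w (Inl n))"
      using Y1[of UNIV] by (subst distr_distr) (auto simp: comp_def)
    also have "\<dots> = distr ?P noise_law (\<lambda>w n. w (Inl n))" by (simp only: law_G)
    also have "\<dots> = noise_law"
      using distr_PiM_reindex[of "UNIV :: (nat + 'n) set" "\<lambda>_. std_normal_distribution" Inl "UNIV :: nat set"]
      by (simp add: prob_space_std_normal restrict_UNIV)
    finally show ?thesis .
  qed
  have Z_law: "distr M borel Z0 = std_gauss"
  proof -
    have "distr M borel Z0
        = distr (distr M (\<Pi>\<^sub>M j\<in>UNIV. borel) (\<lambda>\<omega> j. case_sum g Zc j \<omega>)) borel (\<lambda>w. \<chi> k. w (Inr k))"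
      using Y2[of UNIV] by (subst distr_distr) (auto simp: comp_def)
    also have "\<dots> = distr ?P borel (\<lambda>w. \<chi> k. w (Inr k))" by (simp only: law_G)
    also have "\<dots> = distr (distr ?P (\<Pi>\<^sub>M k\<in>(UNIV::'n set). std_normal_distribution) (\<lambda>w k. w (Inr k))) borel vec_lambda"
    proof (subst distr_distr)
      show "vec_lambda \<in> (\<Pi>\<^sub>M k\<in>(UNIV::'n set). std_normal_distribution) \<rightarrow>\<^sub>M borel"
        by (rule borel_measurable_vecI) simp
      show "(\<lambda>w k. w (Inr k)) \<in> ?P \<rightarrow>\<^sub>M (\<Pi>\<^sub>M k\<in>(UNIV::'n set). std_normal_distribution)"
        by (rule measurable_PiM_single') (auto simp: space_PiM)
    qed (simp add: comp_def)
    also have "distr ?P (\<Pi>\<^sub>M k\<in>(UNIV::'n set). std_normal_distribution) (\<lambda>w k. w (Inr k)) = (\<Pi>\<^sub>M k\<in>UNIV. std_normal_distribution)"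
      using distr_PiM_reindex[of "UNIV :: (nat + 'n) set" "\<lambda>_. std_normal_distribution" Inr "UNIV :: 'n set"]
      by (simp add: prob_space_std_normal restrict_UNIV)
    finally show ?thesis by (simp add: std_gauss_eq_distr_PiM)
  qed
  let ?L = "PiM (range Inl) (\<lambda>_. borel) :: (nat + 'n \<Rightarrow> real) measure"
    and ?R = "PiM (range Inr) (\<lambda>_. borel) :: (nat + 'n \<Rightarrow> real) measure"
  let ?l = "\<lambda>\<omega>. restrict (\<lambda>j. case_sum g Zc j \<omega>) (range Inl)"
    and ?r = "\<lambda>\<omega>. restrict (\<lambda>j. case_sum g Zc j \<omega>) (range Inr)"
  have "indep_var ?L ?l ?R ?r"
    by (rule indep_var_restrict[OF G_indep]) auto
  then have lr[measurable]: "?l \<in> M \<rightarrow>\<^sub>M ?L" "?r \<in> M \<rightarrow>\<^sub>M ?R"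
    and law_lr: "distr M ?L ?l \<Otimes>\<^sub>M distr M ?R ?r = distr M (?L \<Otimes>\<^sub>M ?R) (\<lambda>\<omega>. (?l \<omega>, ?r \<omega>))"
    by (auto simp: indep_var_distribution_eq)
  note Y1' = Y1[of "range Inl", OF order_refl] and Y2' = Y2[of "range Inr", OF order_refl]
  have "noise_law \<Otimes>\<^sub>M std_gauss
      = distr (distr M ?L ?l) noise_law (\<lambda>w n. w (Inl n)) \<Otimes>\<^sub>M distr (distr M ?R ?r) borel (\<lambda>w. \<chi> k. w (Inr k))"
    using lr Y1' Y2' by (simp add: distr_distr comp_def g_law Z_law)
  also have "\<dots> = distr (distr M ?L ?l \<Otimes>\<^sub>M distr M ?R ?r) (noise_law \<Otimes>\<^sub>M borel)
      (\<lambda>(x, y). (\<lambda>n. x (Inl n), \<chi> k. y (Inr k)))"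
  proof (rule pair_measure_distr)
    show "sigma_finite_measure (distr (distr M ?R ?r) borel (\<lambda>w. (\<chi> k. w (Inr k)) :: real^'n))"
      using lr(2) Y2' prob_space_imp_sigma_finite[OF prob_space_std_gauss]
      by (simp add: distr_distr comp_def Z_law)
  qed (use Y1' Y2' in simp_all)
  also have "\<dots> = distr M (noise_law \<Otimes>\<^sub>M borel) (\<lambda>\<omega>. (\<lambda>n. g n \<omega>, Z0 \<omega>))"
  proof -
    note [measurable] = Y1' Y2'
    show ?thesis unfolding law_lr by (subst distr_distr) (auto simp: comp_def case_prod_beta)
  qed
  also have "\<dots> = distr M (noise_law \<Otimes>\<^sub>M std_gauss) (\<lambda>\<omega>. (\<lambda>n. g n \<omega>, Z0 \<omega>))"
    by (intro distr_cong sets_pair_measure_cong) auto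
  finally show ?thesis ..
qed

lemma law_I: "distr M (\<Pi>\<^sub>M n\<in>UNIV. count_space UNIV) (\<lambda>\<omega> n. I n \<omega>) = index_law"
proof -
  have "distr M (count_space UNIV) (I n) = uniform_index" for n
  proof (rule measure_eqI_finite[of _ UNIV])
    fix k :: 'n
    have "emeasure (distr M (count_space UNIV) (I n)) {k} = emeasure M {\<omega> \<in> space M. I n \<omega> = k}"
      by (subst emeasure_distr) (auto intro!: arg_cong[of _ _ "emeasure M"])
    also have "\<dots> = ennreal (1 / real CARD('n))" using I_unif by (simp add: emeasure_eq_measure)
    also have "\<dots> = emeasure uniform_index {k}" by (simp add: emeasure_pmf_single)
    finally show "emeasure (distr M (count_space UNIV) (I n)) {k} = emeasure uniform_index {k}" .
  qed auto
  then show ?thesis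
    using indep_vars_iff_distr_eq_PiM[where I=UNIV and M'="\<lambda>_. count_space UNIV" and X=I] I_indep I_meas
    by (simp add: restrict_UNIV)
qed

abbreviation chain :: "'a \<Rightarrow> (nat \<Rightarrow> 'n) \<times> (nat \<Rightarrow> real) \<times> (real^'n)" where
  "chain \<omega> \<equiv> (\<lambda>n. I n \<omega>, \<lambda>n. g n \<omega>, Z0 \<omega>)"

text \<open>The independence hypothesis concerns the sigma-algebras generated by the whole index
  sequence and the whole Gaussian family. On rectangles it is the product formula, so the joint law
  is a product; mapping the Gaussian factor to noise and start finishes the identification.\<close>

lemma law_chain: "distr M chain_law chain = chain_law"
proof -
  let ?Y = "\<lambda>w :: nat + 'n \<Rightarrow> real. (\<lambda>n. w (Inl n), \<chi> k. w (Inr k))"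
  have [measurable]: "(\<lambda>\<omega> n. I n \<omega>) \<in> M \<rightarrow>\<^sub>M (\<Pi>\<^sub>M n\<in>UNIV. count_space UNIV)"
    by (intro measurable_PiM_single') (auto simp: space_PiM)
  have [measurable]: "(\<lambda>\<omega> j. case_sum g Zc j \<omega>) \<in> M \<rightarrow>\<^sub>M (\<Pi>\<^sub>M j\<in>UNIV. borel)"
    using G_meas by (intro measurable_PiM_single') (auto simp: space_PiM)
  let ?CI = "\<Pi>\<^sub>M n\<in>(UNIV :: nat set). count_space (UNIV :: 'n set)"
    and ?CG = "\<Pi>\<^sub>M j\<in>(UNIV :: (nat + 'n) set). (borel :: real measure)"
  let ?i = "\<lambda>\<omega> n. I n \<omega>" and ?G = "\<lambda>\<omega> j. case_sum g Zc j \<omega>"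
  have ind: "distr M ?CI ?i \<Otimes>\<^sub>M distr M ?CG ?G = distr M (?CI \<Otimes>\<^sub>M ?CG) (\<lambda>\<omega>. (?i \<omega>, ?G \<omega>))"
  proof (rule pair_measure_eqI)
    fix A B assume AB: "A \<in> sets (distr M ?CI ?i)" "B \<in> sets (distr M ?CG ?G)"
    then have [measurable]: "A \<in> sets ?CI" "B \<in> sets ?CG" by simp_all
    have "emeasure (distr M (?CI \<Otimes>\<^sub>M ?CG) (\<lambda>\<omega>. (?i \<omega>, ?G \<omega>))) (A \<times> B)
        = emeasure M ((?i -` A \<inter> space M) \<inter> (?G -` B \<inter> space M))"
      by (subst emeasure_distr) (auto intro!: arg_cong[of _ _ "emeasure M"])
    also have "\<dots> = ennreal (prob (?i -` A \<inter> space M) * prob (?G -` B \<inter> space M))"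
      unfolding emeasure_eq_measure
      by (intro arg_cong[of _ _ ennreal] indep_setD[OF IG_indep] in_vimage_algebra) simp_all
    also have "\<dots> = emeasure (distr M ?CI ?i) A * emeasure (distr M ?CG ?G) B"
      by (simp add: emeasure_distr emeasure_eq_measure ennreal_mult)
    finally show "emeasure (distr M ?CI ?i) A * emeasure (distr M ?CG ?G) B
        = emeasure (distr M (?CI \<Otimes>\<^sub>M ?CG) (\<lambda>\<omega>. (?i \<omega>, ?G \<omega>))) (A \<times> B)" ..
  next
    show "sigma_finite_measure (distr M ?CI ?i)" "sigma_finite_measure (distr M ?CG ?G)"
      by (intro prob_space_imp_sigma_finite prob_space_distr; measurable)+
    show "sets (distr M ?CI ?i \<Otimes>\<^sub>M distr M ?CG ?G) = sets (distr M (?CI \<Otimes>\<^sub>M ?CG) (\<lambda>\<omega>. (?i \<omega>, ?G \<omega>)))"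
      by (simp cong: sets_pair_measure_cong)
  qed
  have Y: "?Y \<in> (\<Pi>\<^sub>M j\<in>UNIV. borel) \<rightarrow>\<^sub>M noise_law \<Otimes>\<^sub>M std_gauss"
  proof (rule measurable_Pair)
    show "(\<lambda>w. \<lambda>n. w (Inl n)) \<in> (\<Pi>\<^sub>M j\<in>UNIV. borel) \<rightarrow>\<^sub>M noise_law"
      by (rule measurable_PiM_single') (auto simp: space_PiM)
    have "(\<lambda>w. \<chi> k. w (Inr k)) \<in> (\<Pi>\<^sub>M j\<in>UNIV. borel) \<rightarrow>\<^sub>M (borel :: (real^'n) measure)"
      by (rule borel_measurable_vecI) auto
    then show "(\<lambda>w. \<chi> k. w (Inr k)) \<in> (\<Pi>\<^sub>M j\<in>UNIV. borel) \<rightarrow>\<^sub>M (std_gauss :: (real^'n) measure)"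
      by (simp cong: measurable_cong_sets)
  qed
  have YG: "distr (distr M ?CG ?G) (noise_law \<Otimes>\<^sub>M std_gauss) ?Y = noise_law \<Otimes>\<^sub>M std_gauss"
    using Y by (simp add: distr_distr comp_def law_noise)
  have "index_law \<Otimes>\<^sub>M (noise_law \<Otimes>\<^sub>M std_gauss)
      = distr (distr M ?CI ?i) ?CI (\<lambda>x. x) \<Otimes>\<^sub>M distr (distr M ?CG ?G) (noise_law \<Otimes>\<^sub>M std_gauss) ?Y"
    unfolding YG by (subst distr_distr) (simp_all add: comp_def law_I)
  also have "\<dots> = distr (distr M ?CI ?i \<Otimes>\<^sub>M distr M ?CG ?G) (?CI \<Otimes>\<^sub>M (noise_law \<Otimes>\<^sub>M std_gauss)) (\<lambda>(x, w). (x, ?Y w))"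
  proof (rule pair_measure_distr)
    show "sigma_finite_measure (distr (distr M ?CG ?G) (noise_law \<Otimes>\<^sub>M std_gauss) ?Y)"
      unfolding YG
      by (intro prob_space_imp_sigma_finite prob_space_pair prob_space_noise_law prob_space_std_gauss)
  qed (use Y in simp_all)
  also have "\<dots> = distr M (?CI \<Otimes>\<^sub>M (noise_law \<Otimes>\<^sub>M std_gauss)) chain"
  proof -
    note [measurable] = Y
    show ?thesis unfolding ind by (subst distr_distr) (auto simp: comp_def case_prod_beta)
  qed
  also have "\<dots> = distr M chain_law chain"
    unfolding chain_law_def by (intro distr_cong sets_pair_measure_cong sets_PiM_cong) auto
  finally show ?thesis by (simp add: chain_law_def)
qed

lemma measurable_chain [measurable]: "chain \<in> M \<rightarrow>\<^sub>M chain_law"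
proof -
  have "(\<lambda>\<omega> n. I n \<omega>) \<in> M \<rightarrow>\<^sub>M index_law" "(\<lambda>\<omega> n. g n \<omega>) \<in> M \<rightarrow>\<^sub>M noise_law"
    by (rule measurable_PiM_single'; simp add: space_PiM cong: measurable_cong_sets)+
  then show ?thesis unfolding chain_law_def by (intro measurable_Pair) (auto cong: measurable_cong_sets)
qed

text \<open>Conditioning on the indices, written as an iterated integral: they run over their law
  while noise and start stay on M. The inner integral has a frozen index sequence, as the Lipschitz
  hypothesis requires.\<close>

lemma nn_integral_disintegrate:
  assumes F[measurable]: "F \<in> borel_measurable chain_law"
  shows "(\<integral>\<^sup>+\<omega>. F (chain \<omega>) \<partial>M) = (\<integral>\<^sup>+i. \<integral>\<^sup>+\<omega>. F (i, \<lambda>n. g n \<omega>, Z0 \<omega>) \<partial>M \<partial>index_law)"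
proof -
  interpret N: prob_space noise_law by (rule prob_space_noise_law)
  interpret G: prob_space "std_gauss :: (real^'n) measure" by (rule prob_space_std_gauss)
  interpret NG: pair_prob_space noise_law "std_gauss :: (real^'n) measure" ..
  have F'[measurable]: "F \<in> borel_measurable (index_law \<Otimes>\<^sub>M (noise_law \<Otimes>\<^sub>M std_gauss))"
    using F by (simp add: chain_law_def)
  have [measurable]: "(\<lambda>\<omega> n. g n \<omega>) \<in> M \<rightarrow>\<^sub>M noise_law"
    by (rule measurable_PiM_single'; simp add: space_PiM)
  have [measurable]: "Z0 \<in> M \<rightarrow>\<^sub>M std_gauss" by (simp cong: measurable_cong_sets)
  have "(\<integral>\<^sup>+\<omega>. F (chain \<omega>) \<partial>M) = (\<integral>\<^sup>+x. F x \<partial>distr M chain_law chain)"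
    by (subst nn_integral_distr) auto
  also have "\<dots> = (\<integral>\<^sup>+x. F x \<partial>chain_law)" by (simp only: law_chain)
  also have "\<dots> = (\<integral>\<^sup>+i. \<integral>\<^sup>+y. F (i, y) \<partial>(noise_law \<Otimes>\<^sub>M std_gauss) \<partial>index_law)"
    by (simp add: chain_law_def NG.nn_integral_fst[symmetric])
  also have "\<dots> = (\<integral>\<^sup>+i. \<integral>\<^sup>+\<omega>. F (i, \<lambda>n. g n \<omega>, Z0 \<omega>) \<partial>M \<partial>index_law)"
  proof (rule nn_integral_cong)
    fix i assume i: "i \<in> space (index_law :: (nat \<Rightarrow> 'n) measure)"
    have "(\<lambda>y. F (i, y)) \<in> borel_measurable (noise_law \<Otimes>\<^sub>M std_gauss)" using i by measurable
    then show "(\<integral>\<^sup>+y. F (i, y) \<partial>(noise_law \<Otimes>\<^sub>M std_gauss)) = (\<integral>\<^sup>+\<omega>. F (i, \<lambda>n. g n \<omega>, Z0 \<omega>) \<partial>M)"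
      by (subst law_noise[symmetric], subst nn_integral_distr) auto
  qed
  finally show ?thesis .
qed

text \<open>Used with b and a the values of h at S Z_0 and at X_j: the latter is a function of
  indices and noise alone.\<close>

lemma indep_noise_Z0:
  fixes a :: "(nat \<Rightarrow> 'n) \<times> (nat \<Rightarrow> real) \<Rightarrow> real" and b :: "real^'n \<Rightarrow> real"
  assumes a[measurable]: "a \<in> borel_measurable (index_law \<Otimes>\<^sub>M noise_law)"
    and b[measurable]: "b \<in> borel_measurable std_gauss"
  shows "indep_var borel (\<lambda>\<omega>. b (Z0 \<omega>)) borel (\<lambda>\<omega>. a (\<lambda>n. I n \<omega>, \<lambda>n. g n \<omega>))"
proof -
  interpret G: prob_space "std_gauss :: (real^'n) measure" by (rule prob_space_std_gauss)
  interpret IN: prob_space "(index_law :: (nat \<Rightarrow> 'n) measure) \<Otimes>\<^sub>M noise_law"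
    by (intro prob_space_pair prob_space_index_law prob_space_noise_law)
  interpret GIN: pair_prob_space "std_gauss :: (real^'n) measure" "(index_law :: (nat \<Rightarrow> 'n) measure) \<Otimes>\<^sub>M noise_law" ..
  let ?IN = "(index_law :: (nat \<Rightarrow> 'n) measure) \<Otimes>\<^sub>M noise_law"
  let ?X = "\<lambda>\<omega>. (\<lambda>n. I n \<omega>, \<lambda>n. g n \<omega>)"
  let ?assoc = "\<lambda>(i :: nat \<Rightarrow> 'n, \<gamma> :: nat \<Rightarrow> real, z :: real^'n). ((i, \<gamma>), z)"
  have [measurable]: "?assoc \<in> chain_law \<rightarrow>\<^sub>M ?IN \<Otimes>\<^sub>M std_gauss"
    unfolding chain_law_def case_prod_beta by measurable
  have law: "distr M (?IN \<Otimes>\<^sub>M std_gauss) (\<lambda>\<omega>. (?X \<omega>, Z0 \<omega>)) = ?IN \<Otimes>\<^sub>M std_gauss"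
  proof -
    have "distr M (?IN \<Otimes>\<^sub>M std_gauss) (\<lambda>\<omega>. (?X \<omega>, Z0 \<omega>))
        = distr (distr M chain_law chain) (?IN \<Otimes>\<^sub>M std_gauss) ?assoc"
      by (subst distr_distr) (auto simp: comp_def)
    then show ?thesis by (simp only: law_chain distr_chain_law_assoc)
  qed
  have XZ: "(\<lambda>\<omega>. (?X \<omega>, Z0 \<omega>)) \<in> M \<rightarrow>\<^sub>M ?IN \<Otimes>\<^sub>M std_gauss"
    using measurable_compose[OF measurable_chain, of ?assoc] by simp
  have [measurable]: "?X \<in> M \<rightarrow>\<^sub>M ?IN" "Z0 \<in> M \<rightarrow>\<^sub>M std_gauss"
    using measurable_compose[OF XZ measurable_fst] measurable_compose[OF XZ measurable_snd] by simp_all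
  have swap: "distr M (std_gauss \<Otimes>\<^sub>M ?IN) (\<lambda>\<omega>. (Z0 \<omega>, ?X \<omega>)) = std_gauss \<Otimes>\<^sub>M ?IN"
  proof -
    have "distr M (std_gauss \<Otimes>\<^sub>M ?IN) (\<lambda>\<omega>. (Z0 \<omega>, ?X \<omega>))
        = distr (distr M (?IN \<Otimes>\<^sub>M std_gauss) (\<lambda>\<omega>. (?X \<omega>, Z0 \<omega>))) (std_gauss \<Otimes>\<^sub>M ?IN) (\<lambda>(x, y). (y, x))"
      by (subst distr_distr) (auto simp: comp_def)
    then show ?thesis unfolding law by (simp only: GIN.distr_pair_swap[symmetric])
  qed
  have laws: "distr M std_gauss Z0 = std_gauss" "distr M ?IN ?X = ?IN"
  proof -
    have "distr M std_gauss Z0 = distr (distr M (std_gauss \<Otimes>\<^sub>M ?IN) (\<lambda>\<omega>. (Z0 \<omega>, ?X \<omega>))) std_gauss fst"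
      by (subst distr_distr) (auto simp: comp_def)
    then show "distr M std_gauss Z0 = std_gauss" unfolding swap by (simp add: IN.distr_pair_fst)
    have "distr M ?IN ?X = distr (distr M (?IN \<Otimes>\<^sub>M std_gauss) (\<lambda>\<omega>. (?X \<omega>, Z0 \<omega>))) ?IN fst"
      by (subst distr_distr) (auto simp: comp_def)
    then show "distr M ?IN ?X = ?IN" unfolding law by (simp add: G.distr_pair_fst)
  qed
  have "distr M borel (\<lambda>\<omega>. b (Z0 \<omega>)) \<Otimes>\<^sub>M distr M borel (\<lambda>\<omega>. a (?X \<omega>))
      = distr (distr M std_gauss Z0) borel b \<Otimes>\<^sub>M distr (distr M ?IN ?X) borel a"
    by (simp add: distr_distr comp_def)
  also have "\<dots> = distr std_gauss borel b \<Otimes>\<^sub>M distr ?IN borel a" by (simp only: laws)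
  also have "\<dots> = distr (std_gauss \<Otimes>\<^sub>M ?IN) (borel \<Otimes>\<^sub>M borel) (\<lambda>(x, y). (b x, a y))"
    by (intro pair_measure_distr prob_space_imp_sigma_finite IN.prob_space_distr a b)
  also have "\<dots> = distr M (borel \<Otimes>\<^sub>M borel) (\<lambda>\<omega>. (b (Z0 \<omega>), a (?X \<omega>)))"
    by (subst swap[symmetric], subst distr_distr) (auto simp: comp_def case_prod_beta)
  finally show ?thesis by (simp add: indep_var_distribution_eq)
qed

section \<open>Gaussian comparison for a frozen index sequence\<close>

lemma noise_combination:
  fixes \<alpha> :: "nat \<Rightarrow> real" and \<beta> :: "real^'n" and n :: nat
  defines "L \<equiv> \<lambda>\<omega>. (\<Sum>m<n. \<alpha> m * g m \<omega>) + \<beta> \<bullet> Z0 \<omega>"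
  shows "centered_normal_law (distr M borel L)"
    and "integrable M (\<lambda>\<omega>. (L \<omega>)\<^sup>2)"
    and "expectation (\<lambda>\<omega>. (L \<omega>)\<^sup>2) = (\<Sum>m<n. (\<alpha> m)\<^sup>2) + (norm \<beta>)\<^sup>2"
proof -
  let ?A = "{..<n} <+> (UNIV :: 'n set)" and ?c = "case_sum \<alpha> (\<lambda>k. \<beta> $ k)"
  have L: "L = (\<lambda>\<omega>. \<Sum>j\<in>?A. ?c j * case_sum g Zc j \<omega>)"
    by (simp add: L_def sum.Plus inner_vec_def)
  have c: "(\<Sum>j\<in>?A. (?c j)\<^sup>2) = (\<Sum>m<n. (\<alpha> m)\<^sup>2) + (norm \<beta>)\<^sup>2"
    by (simp add: sum.Plus norm_vec_def L2_set_def sum_nonneg)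
  have fin: "finite ?A" by simp
  have ind: "indep_vars (\<lambda>_. borel) (case_sum g Zc) ?A"
    by (rule indep_vars_subset[OF G_indep]) simp
  note comb = std_normal_linear_combination[OF fin ind G_normal[rule_format], of ?c]
  show "centered_normal_law (distr M borel L)" "integrable M (\<lambda>\<omega>. (L \<omega>)\<^sup>2)"
    "expectation (\<lambda>\<omega>. (L \<omega>)\<^sup>2) = (\<Sum>m<n. (\<alpha> m)\<^sup>2) + (norm \<beta>)\<^sup>2"
    using comb by (simp_all only: L c)
qed

lemma norm_f: "norm (f k) = 1"
  by (rule norm_fvec[OF V_pd V_diag])

lemma norm_sqrt_mult: "(norm (S *v u))\<^sup>2 = u \<bullet> (V *v u)"
  using symmetric_inner_matrix_vector[OF mat_sqrt_pd(1)[OF V_pd], of u "S *v u"]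
  by (simp add: power2_norm_eq_inner matrix_vector_mul_assoc mat_sqrt_pd(2)[OF V_pd])

lemma measurable_walk_fixed_index [measurable]:
  "(\<lambda>\<omega>. walk f i (\<lambda>n. g n \<omega>) (Z0 \<omega>) n) \<in> borel_measurable M"
  "(\<lambda>\<omega>. walk f i (\<lambda>n. g n \<omega>) 0 n) \<in> borel_measurable M"
  "(\<lambda>\<omega>. walk f i (\<lambda>_. 0) (Z0 \<omega>) n) \<in> borel_measurable M"
  by (rule measurable_walk; simp)+

text \<open>The pair \<open>(X\<^sub>j, S Z\<^sub>j)\<close> is Gaussian only for a fixed index sequence; with random indices it is a
  mixture, to which the Lipschitz hypothesis does not apply.\<close>

lemma gauss_lipschitz_fixed_index:
  assumes h_lip: "gauss_lipschitz \<kappa> \<gamma> V h"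
  shows "(\<integral>\<^sup>+\<omega>. ennreal ((h (S *v walk f i (\<lambda>n. g n \<omega>) 0 j) - h (S *v walk f i (\<lambda>n. g n \<omega>) (Z0 \<omega>) j))\<^sup>2) \<partial>M)
    \<le> ennreal (\<kappa>\<^sup>2 * (\<integral>\<omega>. (norm (S *v walk f i (\<lambda>_. 0) (Z0 \<omega>) j))\<^sup>2 \<partial>M) powr \<gamma>)"
proof -
  have [measurable]: "h \<in> borel_measurable borel" using h_lip by (simp add: gauss_lipschitz_def)
  let ?Y = "\<lambda>\<omega>. S *v walk f i (\<lambda>n. g n \<omega>) 0 j" and ?Z = "\<lambda>\<omega>. S *v walk f i (\<lambda>n. g n \<omega>) (Z0 \<omega>) j"
  define Q where "Q = distr M (borel \<Otimes>\<^sub>M borel) (\<lambda>\<omega>. (?Y \<omega>, ?Z \<omega>))"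
  \<comment> \<open>Both walks share the noise and hence the coefficients \<alpha>; only the second
    sees the start. The variance of u . X_j is thus the part of u . V u carried by \<alpha>, and
    that of u . S Z_j is all of it, so both covariances are at most V.\<close>
  have combs: "\<exists>\<alpha> \<beta>. (\<forall>\<omega>. u \<bullet> ?Y \<omega> = (\<Sum>m<j. \<alpha> m * g m \<omega>))
      \<and> (\<forall>\<omega>. u \<bullet> ?Z \<omega> = (\<Sum>m<j. \<alpha> m * g m \<omega>) + \<beta> \<bullet> Z0 \<omega>)
      \<and> (\<Sum>m<j. (\<alpha> m)\<^sup>2) + (norm \<beta>)\<^sup>2 = u \<bullet> (V *v u)" for u
  proof -
    obtain \<alpha> and \<beta> :: "real^'n" where ab: "\<And>\<gamma> z. (S *v u) \<bullet> walk f i \<gamma> z j = (\<Sum>m<j. \<alpha> m * \<gamma> m) + \<beta> \<bullet> z"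
      "(\<Sum>m<j. (\<alpha> m)\<^sup>2) + (norm \<beta>)\<^sup>2 = (norm (S *v u))\<^sup>2"
      using inner_walk_eq_linear_combination[where f=f and v="S *v u" and i=i and n=j, OF norm_f] by blast
    then show ?thesis
      using symmetric_inner_matrix_vector[OF mat_sqrt_pd(1)[OF V_pd], of u]
      by (intro exI[of _ \<alpha>] exI[of _ \<beta>]) (simp add: norm_sqrt_mult)
  qed
  have "prob_space Q" unfolding Q_def by (rule prob_space_distr) measurable
  moreover have "sets Q = sets borel" by (simp add: Q_def borel_prod)
  moreover have "centered_normal_law (distr Q borel (\<lambda>p. u \<bullet> fst p + v \<bullet> snd p))" for u v
  proof -
    obtain \<alpha> where u: "\<And>\<omega>. u \<bullet> ?Y \<omega> = (\<Sum>m<j. \<alpha> m * g m \<omega>)" using combs[of u] by blast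
    obtain \<alpha>' \<beta>' where v: "\<And>\<omega>. v \<bullet> ?Z \<omega> = (\<Sum>m<j. \<alpha>' m * g m \<omega>) + \<beta>' \<bullet> Z0 \<omega>" using combs[of v] by blast
    have "distr Q borel (\<lambda>p. u \<bullet> fst p + v \<bullet> snd p) = distr M borel (\<lambda>\<omega>. u \<bullet> ?Y \<omega> + v \<bullet> ?Z \<omega>)"
      unfolding Q_def by (subst distr_distr) (auto simp: comp_def)
    also have "(\<lambda>\<omega>. u \<bullet> ?Y \<omega> + v \<bullet> ?Z \<omega>) = (\<lambda>\<omega>. (\<Sum>m<j. (\<alpha> m + \<alpha>' m) * g m \<omega>) + \<beta>' \<bullet> Z0 \<omega>)"
      unfolding u v by (simp add: sum.distrib algebra_simps)
    finally show ?thesis using noise_combination(1)[where n=j and \<alpha>="\<lambda>m. \<alpha> m + \<alpha>' m" and \<beta>=\<beta>'] by simp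
  qed
  moreover have "(\<integral>p. (u \<bullet> fst p)\<^sup>2 \<partial>Q) \<le> u \<bullet> (V *v u)" for u
  proof -
    obtain \<alpha> and \<beta> :: "real^'n" where u: "\<And>\<omega>. u \<bullet> ?Y \<omega> = (\<Sum>m<j. \<alpha> m * g m \<omega>)"
      "(\<Sum>m<j. (\<alpha> m)\<^sup>2) + (norm \<beta>)\<^sup>2 = u \<bullet> (V *v u)" using combs[of u] by blast
    have "(\<integral>p. (u \<bullet> fst p)\<^sup>2 \<partial>Q) = (\<integral>\<omega>. (u \<bullet> ?Y \<omega>)\<^sup>2 \<partial>M)"
      unfolding Q_def by (subst integral_distr) auto
    also have "\<dots> = (\<Sum>m<j. (\<alpha> m)\<^sup>2)"
      unfolding u using noise_combination(3)[where n=j and \<alpha>=\<alpha> and \<beta>=0] by simp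
    also have "\<dots> \<le> u \<bullet> (V *v u)" unfolding u(2)[symmetric] by simp
    finally show ?thesis .
  qed
  moreover have "(\<integral>p. (u \<bullet> snd p)\<^sup>2 \<partial>Q) \<le> u \<bullet> (V *v u)" for u
  proof -
    obtain \<alpha> and \<beta> :: "real^'n" where u: "\<And>\<omega>. u \<bullet> ?Z \<omega> = (\<Sum>m<j. \<alpha> m * g m \<omega>) + \<beta> \<bullet> Z0 \<omega>"
      "(\<Sum>m<j. (\<alpha> m)\<^sup>2) + (norm \<beta>)\<^sup>2 = u \<bullet> (V *v u)" using combs[of u] by blast
    have "(\<integral>p. (u \<bullet> snd p)\<^sup>2 \<partial>Q) = (\<integral>\<omega>. (u \<bullet> ?Z \<omega>)\<^sup>2 \<partial>M)"
      unfolding Q_def by (subst integral_distr) auto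
    also have "\<dots> = u \<bullet> (V *v u)"
      unfolding u(1) u(2)[symmetric] by (rule noise_combination(3))
    finally show ?thesis by simp
  qed
  ultimately have "(\<integral>\<^sup>+p. ennreal ((h (fst p) - h (snd p))\<^sup>2) \<partial>Q)
      \<le> ennreal (\<kappa>\<^sup>2 * (\<integral>p. (norm (fst p - snd p))\<^sup>2 \<partial>Q) powr \<gamma>)"
    using h_lip by (simp add: gauss_lipschitz_def centered_gaussian_pair_def)
  also have "(\<integral>\<^sup>+p. ennreal ((h (fst p) - h (snd p))\<^sup>2) \<partial>Q) = (\<integral>\<^sup>+\<omega>. ennreal ((h (?Y \<omega>) - h (?Z \<omega>))\<^sup>2) \<partial>M)"
    unfolding Q_def by (subst nn_integral_distr) auto
  also have "(\<integral>p. (norm (fst p - snd p))\<^sup>2 \<partial>Q) = (\<integral>\<omega>. (norm (?Y \<omega> - ?Z \<omega>))\<^sup>2 \<partial>M)"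
    unfolding Q_def by (subst integral_distr) auto
  also have "\<dots> = (\<integral>\<omega>. (norm (S *v walk f i (\<lambda>_. 0) (Z0 \<omega>) j))\<^sup>2 \<partial>M)"
  proof -
    have "?Z \<omega> = ?Y \<omega> + S *v walk f i (\<lambda>_. 0) (Z0 \<omega>) j" for \<omega>
      by (subst walk_superposition) (simp add: matrix_vector_right_distrib)
    then have "norm (?Y \<omega> - ?Z \<omega>) = norm (S *v walk f i (\<lambda>_. 0) (Z0 \<omega>) j)" for \<omega> by simp
    then show ?thesis by simp
  qed
  finally show ?thesis .
qed

lemma norm_Z0_square:
  "integrable M (\<lambda>\<omega>. (norm (Z0 \<omega>))\<^sup>2)" "expectation (\<lambda>\<omega>. (norm (Z0 \<omega>))\<^sup>2) = CARD('n)"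
proof -
  have nrm: "(norm (Z0 \<omega>))\<^sup>2 = (\<Sum>k\<in>UNIV. (Zc k \<omega>)\<^sup>2)" for \<omega>
    by (simp add: norm_vec_def L2_set_def sum_nonneg)
  have "integrable M (\<lambda>\<omega>. (Zc k \<omega>)\<^sup>2)" "expectation (\<lambda>\<omega>. (Zc k \<omega>)\<^sup>2) = 1" for k
    using noise_combination(2,3)[where n=0 and \<beta>="axis k 1"] by (simp_all add: inner_axis')
  then show "integrable M (\<lambda>\<omega>. (norm (Z0 \<omega>))\<^sup>2)" "expectation (\<lambda>\<omega>. (norm (Z0 \<omega>))\<^sup>2) = CARD('n)"
    unfolding nrm by simp_all
qed

text \<open>With the indices frozen, the distance is governed by q, the conditional mean square of S
  M_j Z_0. Its average over the indices is of order \<rho>^j, and \<open>powr_le_rescaled\<close> at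
  that scale turns the average of q^\<gamma> into order \<rho>^(j \<gamma>).\<close>

lemma chain_L2_contraction:
  assumes h_lip: "gauss_lipschitz \<kappa> \<gamma> V h" and \<gamma>: "0 < \<gamma>" "\<gamma> \<le> 1"
  obtains C r where "0 \<le> C" "0 < r" "r < 1"
    "\<And>j. (\<integral>\<^sup>+\<omega>. ennreal ((h (S *v walk f (\<lambda>n. I n \<omega>) (\<lambda>n. g n \<omega>) 0 j)
        - h (S *v walk f (\<lambda>n. I n \<omega>) (\<lambda>n. g n \<omega>) (Z0 \<omega>) j))\<^sup>2) \<partial>M) \<le> ennreal (C * (r ^ j)\<^sup>2)"
proof -
  have [measurable]: "h \<in> borel_measurable borel" using h_lip by (simp add: gauss_lipschitz_def)
  interpret IL: prob_space "index_law :: (nat \<Rightarrow> 'n) measure" by (rule prob_space_index_law)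
  interpret IM: pair_sigma_finite "index_law :: (nat \<Rightarrow> 'n) measure" M ..
  obtain \<rho> where \<rho>: "0 < \<rho>" "\<rho> < 1"
    "\<And>z. (\<Sum>k\<in>UNIV. (norm (z - (f k \<bullet> z) *\<^sub>R f k))\<^sup>2) / CARD('n) \<le> \<rho> * (norm z)\<^sup>2"
    using fvec_average_contraction[OF V_pd V_diag] by blast
  obtain K where K: "K > 0" "\<And>x. norm (S *v x) \<le> norm x * K"
    using bounded_linear.pos_bounded[OF matrix_vector_mul_bounded_linear[of S]] by blast
  have K_sq: "(norm (S *v x))\<^sup>2 \<le> K\<^sup>2 * (norm x)\<^sup>2" for x
    using power_mono[OF K(2)[of x], of 2] by (simp add: power_mult_distrib mult.commute)
  let ?d = "real CARD('n)"
  define q where "q = (\<lambda>j i. \<integral>\<omega>. (norm (S *v walk f i (\<lambda>_. 0) (Z0 \<omega>) j))\<^sup>2 \<partial>M)"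
  have q0: "0 \<le> q j i" for j i by (simp add: q_def)
  \<comment> \<open>The Lipschitz bound uses a Bochner integral, which would be 0 for a
    non-integrable function. Integrability holds because projections do not increase the norm of
    Z_0.\<close>
  have q_eq: "ennreal (q j i) = (\<integral>\<^sup>+\<omega>. ennreal ((norm (S *v walk f i (\<lambda>_. 0) (Z0 \<omega>) j))\<^sup>2) \<partial>M)" for j i
    unfolding q_def
  proof (rule nn_integral_eq_integral[symmetric])
    show "integrable M (\<lambda>\<omega>. (norm (S *v walk f i (\<lambda>_. 0) (Z0 \<omega>) j))\<^sup>2)"
    proof (rule Bochner_Integration.integrable_bound)
      show "integrable M (\<lambda>\<omega>. K\<^sup>2 * (norm (Z0 \<omega>))\<^sup>2)" using norm_Z0_square(1) by simp
      show "AE \<omega> in M. norm ((norm (S *v walk f i (\<lambda>_. 0) (Z0 \<omega>) j))\<^sup>2) \<le> norm (K\<^sup>2 * (norm (Z0 \<omega>))\<^sup>2)"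
      proof (rule AE_I2)
        fix \<omega>
        have "(norm (S *v walk f i (\<lambda>_. 0) (Z0 \<omega>) j))\<^sup>2 \<le> K\<^sup>2 * (norm (walk f i (\<lambda>_. 0) (Z0 \<omega>) j))\<^sup>2"
          by (rule K_sq)
        also have "\<dots> \<le> K\<^sup>2 * (norm (Z0 \<omega>))\<^sup>2"
          using norm_walk_le[OF norm_f] by (intro mult_left_mono power_mono) auto
        finally show "norm ((norm (S *v walk f i (\<lambda>_. 0) (Z0 \<omega>) j))\<^sup>2) \<le> norm (K\<^sup>2 * (norm (Z0 \<omega>))\<^sup>2)" by simp
      qed
    qed measurable
  qed simp
  have walk_meas: "(\<lambda>x. walk f (fst x) (\<lambda>_. 0) (Z0 (snd x)) j) \<in> borel_measurable (index_law \<Otimes>\<^sub>M M)" for j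
    by (rule measurable_walk) measurable
  have q_int: "(\<integral>\<^sup>+i. ennreal (q j i) \<partial>index_law) \<le> ennreal (K\<^sup>2 * \<rho> ^ j * ?d)" for j
  proof -
    note [measurable] = walk_meas[of j]
    have "(\<integral>\<^sup>+i. ennreal (q j i) \<partial>index_law)
        = (\<integral>\<^sup>+i. \<integral>\<^sup>+\<omega>. ennreal ((norm (S *v walk f i (\<lambda>_. 0) (Z0 \<omega>) j))\<^sup>2) \<partial>M \<partial>index_law)"
      by (simp only: q_eq)
    \<comment> \<open>The order is exchanged so that the contraction is applied for each fixed value
      of Z_0; the mean of |Z_0|^2 then supplies the factor d.\<close>
    also have "\<dots> = (\<integral>\<^sup>+\<omega>. \<integral>\<^sup>+i. ennreal ((norm (S *v walk f i (\<lambda>_. 0) (Z0 \<omega>) j))\<^sup>2) \<partial>index_law \<partial>M)"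
      by (rule IM.Fubini'[symmetric]) (simp add: case_prod_beta)
    also have "\<dots> \<le> (\<integral>\<^sup>+\<omega>. ennreal (K\<^sup>2 * (\<rho> ^ j * (norm (Z0 \<omega>))\<^sup>2)) \<partial>M)"
    proof (rule nn_integral_mono)
      fix \<omega>
      have [measurable]: "(\<lambda>i. walk f i (\<lambda>_. 0) (Z0 \<omega>) j) \<in> borel_measurable index_law"
        by (rule measurable_walk) measurable
      have "(\<integral>\<^sup>+i. ennreal ((norm (S *v walk f i (\<lambda>_. 0) (Z0 \<omega>) j))\<^sup>2) \<partial>index_law)
          \<le> (\<integral>\<^sup>+i. ennreal (K\<^sup>2) * ennreal ((norm (walk f i (\<lambda>_. 0) (Z0 \<omega>) j))\<^sup>2) \<partial>index_law)"
        using K_sq by (intro nn_integral_mono) (simp add: ennreal_leI flip: ennreal_mult)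
      also have "\<dots> = ennreal (K\<^sup>2) * (\<integral>\<^sup>+i. ennreal ((norm (walk f i (\<lambda>_. 0) (Z0 \<omega>) j))\<^sup>2) \<partial>index_law)"
        by (rule nn_integral_cmult) measurable
      also have "\<dots> \<le> ennreal (K\<^sup>2) * ennreal (\<rho> ^ j * (norm (Z0 \<omega>))\<^sup>2)"
        using \<rho> by (intro mult_left_mono nn_integral_norm_walk_le) auto
      finally show "(\<integral>\<^sup>+i. ennreal ((norm (S *v walk f i (\<lambda>_. 0) (Z0 \<omega>) j))\<^sup>2) \<partial>index_law)
          \<le> ennreal (K\<^sup>2 * (\<rho> ^ j * (norm (Z0 \<omega>))\<^sup>2))"
        using \<rho> by (simp add: ennreal_mult)
    qed
    also have "\<dots> = ennreal (\<integral>\<omega>. K\<^sup>2 * (\<rho> ^ j * (norm (Z0 \<omega>))\<^sup>2) \<partial>M)"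
      using \<rho> norm_Z0_square(1) by (intro nn_integral_eq_integral) auto
    also have "\<dots> = ennreal (K\<^sup>2 * \<rho> ^ j * ?d)" using norm_Z0_square by (simp add: mult.assoc)
    finally show ?thesis .
  qed
  have q_meas[measurable]: "(\<lambda>i. ennreal (q j i)) \<in> borel_measurable index_law" for j
  proof -
    note [measurable] = walk_meas[of j]
    show ?thesis unfolding q_eq by measurable
  qed
  \<comment> \<open>With t = \<rho>^j and a mean of q of at most K^2 \<rho>^j d, the affine bound
    averages to t^\<gamma> (1 + K^2 d). The exponent in r makes the square of r^j equal to
    t^\<gamma>.\<close>
  define C where "C = \<kappa>\<^sup>2 * (1 + K\<^sup>2 * ?d)"
  define r where "r = \<rho> powr (\<gamma> / 2)"
  show thesis
  proof
    show "0 \<le> C" by (simp add: C_def)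
    show "0 < r" "r < 1" using \<rho> \<gamma> powr_less_mono2[of "\<gamma> / 2" \<rho> 1] by (auto simp: r_def)
    fix j
    let ?t = "\<rho> ^ j"
    have t: "0 < ?t" using \<rho> by simp
    have rt: "(r ^ j)\<^sup>2 = ?t powr \<gamma>"
    proof -
      have "(r ^ j)\<^sup>2 = \<rho> powr (\<gamma> / 2 * real (j * 2))"
        unfolding r_def power_mult[symmetric] using \<rho> by (simp add: powr_realpow[symmetric] powr_powr)
      also have "\<dots> = (\<rho> powr real j) powr \<gamma>" by (simp add: powr_powr mult_ac)
      finally show ?thesis using \<rho> by (simp add: powr_realpow)
    qed
    \<comment> \<open>Overwriting the start by 0 expresses X_j on the same space as Z_j, so that the
      disintegration covers both at once.\<close>
    let ?F = "\<lambda>x. ennreal ((h (S *v chain_path f j (fst x, fst (snd x), 0)) - h (S *v chain_path f j x))\<^sup>2)"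
    have "(\<lambda>x. chain_path f j (fst x, fst (snd x), 0)) \<in> borel_measurable chain_law"
      unfolding chain_path_def chain_law_def by (simp, rule measurable_walk) measurable
    note [measurable] = this
    have "(\<integral>\<^sup>+\<omega>. ennreal ((h (S *v walk f (\<lambda>n. I n \<omega>) (\<lambda>n. g n \<omega>) 0 j)
        - h (S *v walk f (\<lambda>n. I n \<omega>) (\<lambda>n. g n \<omega>) (Z0 \<omega>) j))\<^sup>2) \<partial>M) = (\<integral>\<^sup>+\<omega>. ?F (chain \<omega>) \<partial>M)"
      by (simp add: chain_path_def)
    also have "\<dots> = (\<integral>\<^sup>+i. \<integral>\<^sup>+\<omega>. ennreal ((h (S *v walk f i (\<lambda>n. g n \<omega>) 0 j)
        - h (S *v walk f i (\<lambda>n. g n \<omega>) (Z0 \<omega>) j))\<^sup>2) \<partial>M \<partial>index_law)"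
    proof -
      have "?F \<in> borel_measurable chain_law" by measurable
      from nn_integral_disintegrate[OF this] show ?thesis by (simp add: chain_path_def)
    qed
    also have "\<dots> \<le> (\<integral>\<^sup>+i. ennreal (\<kappa>\<^sup>2 * q j i powr \<gamma>) \<partial>index_law)"
      unfolding q_def by (intro nn_integral_mono gauss_lipschitz_fixed_index h_lip)
    also have "\<dots> \<le> (\<integral>\<^sup>+i. ennreal (\<kappa>\<^sup>2 * ?t powr \<gamma>) * (1 + ennreal (1 / ?t) * ennreal (q j i)) \<partial>index_law)"
    proof (rule nn_integral_mono)
      fix i
      have "\<kappa>\<^sup>2 * q j i powr \<gamma> \<le> \<kappa>\<^sup>2 * (?t powr \<gamma> * (1 + q j i / ?t))"
        using powr_le_rescaled[OF q0 t \<gamma>] by (intro mult_left_mono) auto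
      also have "\<dots> = \<kappa>\<^sup>2 * ?t powr \<gamma> * (1 + 1 / ?t * q j i)" by simp
      finally have "ennreal (\<kappa>\<^sup>2 * q j i powr \<gamma>) \<le> ennreal (\<kappa>\<^sup>2 * ?t powr \<gamma> * (1 + 1 / ?t * q j i))"
        by (rule ennreal_leI)
      also have "\<dots> = ennreal (\<kappa>\<^sup>2 * ?t powr \<gamma>) * (1 + ennreal (1 / ?t) * ennreal (q j i))"
        using q0[of j i] t by (simp add: ennreal_mult' ennreal_plus del: times_divide_eq_left)
      finally show "ennreal (\<kappa>\<^sup>2 * q j i powr \<gamma>) \<le> ennreal (\<kappa>\<^sup>2 * ?t powr \<gamma>) * (1 + ennreal (1 / ?t) * ennreal (q j i))" .
    qed
    also have "\<dots> = ennreal (\<kappa>\<^sup>2 * ?t powr \<gamma>) * (1 + ennreal (1 / ?t) * (\<integral>\<^sup>+i. ennreal (q j i) \<partial>index_law))"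
      by (simp add: nn_integral_cmult nn_integral_add IL.emeasure_space_1)
    also have "\<dots> \<le> ennreal (\<kappa>\<^sup>2 * ?t powr \<gamma>) * (1 + ennreal (1 / ?t) * ennreal (K\<^sup>2 * ?t * ?d))"
      by (intro mult_left_mono add_left_mono q_int) auto
    also have "\<dots> = ennreal (\<kappa>\<^sup>2 * ?t powr \<gamma> * (1 + 1 / ?t * (K\<^sup>2 * ?t * ?d)))"
      using t by (simp add: ennreal_mult' ennreal_plus del: times_divide_eq_left)
    also have "\<kappa>\<^sup>2 * ?t powr \<gamma> * (1 + 1 / ?t * (K\<^sup>2 * ?t * ?d)) = C * (r ^ j)\<^sup>2"
      unfolding rt C_def using t by simp
    finally show "(\<integral>\<^sup>+\<omega>. ennreal ((h (S *v walk f (\<lambda>n. I n \<omega>) (\<lambda>n. g n \<omega>) 0 j)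
        - h (S *v walk f (\<lambda>n. I n \<omega>) (\<lambda>n. g n \<omega>) (Z0 \<omega>) j))\<^sup>2) \<partial>M) \<le> ennreal (C * (r ^ j)\<^sup>2)" .
  qed
qed

text \<open>The joint law is what is stationary, so one statement serves for square moments, means
  and correlations: a G that ignores its second argument, at k = 0, gives the one-time
  versions.\<close>

lemma stationary_pair:
  fixes G :: "real^'n \<Rightarrow> real^'n \<Rightarrow> real"
  assumes G: "(\<lambda>p. G (fst p) (snd p)) \<in> borel_measurable (borel \<Otimes>\<^sub>M borel)"
  shows "integrable M (\<lambda>\<omega>. G (Zseq V I g Z0 j \<omega>) (Zseq V I g Z0 (j + k) \<omega>))
      \<longleftrightarrow> integrable M (\<lambda>\<omega>. G (Z0 \<omega>) (Zseq V I g Z0 k \<omega>))"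
    and "expectation (\<lambda>\<omega>. G (Zseq V I g Z0 j \<omega>) (Zseq V I g Z0 (j + k) \<omega>))
      = expectation (\<lambda>\<omega>. G (Z0 \<omega>) (Zseq V I g Z0 k \<omega>))"
proof -
  let ?P = "\<lambda>j k \<omega>. (chain_path f j (chain \<omega>), chain_path f k (chain \<omega>))"
  have Z: "chain_path f n (chain \<omega>) = Zseq V I g Z0 n \<omega>" for n \<omega>
    by (simp add: Zseq_eq_walk[OF V_pd V_diag] chain_path_def)
  have Z_0: "Zseq V I g Z0 0 \<omega> = Z0 \<omega>" for \<omega>
    by (simp add: Zseq_eq_walk[OF V_pd V_diag])
  have meas: "?P j k \<in> M \<rightarrow>\<^sub>M borel \<Otimes>\<^sub>M borel" for j k by measurable
  have transfer: "distr M borel (?P j k) = distr chain_law borel (\<lambda>x. (chain_path f j x, chain_path f k x))" for j k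
  proof -
    have "distr (distr M chain_law chain) borel (\<lambda>x. (chain_path f j x, chain_path f k x))
        = distr M borel (?P j k)"
      by (subst distr_distr) (auto simp: comp_def simp flip: borel_prod)
    then show ?thesis by (simp only: law_chain)
  qed
  have "distr M (borel \<Otimes>\<^sub>M borel) (?P j (j + k)) = distr M (borel \<Otimes>\<^sub>M borel) (?P 0 k)"
    unfolding borel_prod transfer by (rule distr_chain_path_pair[OF norm_f])
  note eq = this
  show "integrable M (\<lambda>\<omega>. G (Zseq V I g Z0 j \<omega>) (Zseq V I g Z0 (j + k) \<omega>))
      \<longleftrightarrow> integrable M (\<lambda>\<omega>. G (Z0 \<omega>) (Zseq V I g Z0 k \<omega>))"
    using integrable_distr_eq[OF meas[of j "j + k"] G] integrable_distr_eq[OF meas[of 0 k] G]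
    unfolding eq by (simp add: Z Z_0)
  show "expectation (\<lambda>\<omega>. G (Zseq V I g Z0 j \<omega>) (Zseq V I g Z0 (j + k) \<omega>))
      = expectation (\<lambda>\<omega>. G (Z0 \<omega>) (Zseq V I g Z0 k \<omega>))"
    using integral_distr[OF meas[of j "j + k"] G] integral_distr[OF meas[of 0 k] G]
    unfolding eq by (simp add: Z Z_0)
qed

lemma scaled_mean_square_limit_chain:
  assumes h_lip: "gauss_lipschitz \<kappa> \<gamma> V h" and \<gamma>: "0 < \<gamma>" "\<gamma> \<le> 1"
  defines "U \<equiv> \<lambda>j \<omega>. h (S *v Zseq V I g Z0 j \<omega>)"
  defines "m \<equiv> expectation (\<lambda>\<omega>. h (S *v Z0 \<omega>))"
  defines "cov \<equiv> \<lambda>j. expectation (\<lambda>\<omega>. (U 0 \<omega> - m) * (U j \<omega> - m))"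
  shows "\<And>j. expectation (U j) = m"
    and "summable (\<lambda>j. cov (Suc j))"
    and "(\<lambda>n. real n * expectation (\<lambda>\<omega>. ((\<Sum>j<n. h (Xseq V I g j \<omega>)) / real n - m)\<^sup>2))
      \<longlonglongrightarrow> cov 0 + 2 * (\<Sum>j. cov (Suc j))"
proof -
  have h[measurable]: "h \<in> borel_measurable borel" using h_lip by (simp add: gauss_lipschitz_def)
  define H where "H = (\<lambda>j \<omega>. h (Xseq V I g j \<omega>))"
  have U_eq: "h (S *v Zseq V I g Z0 j \<omega>) = U j \<omega>" for j \<omega> by (simp add: U_def)
  have U_walk: "U j \<omega> = h (S *v walk f (\<lambda>n. I n \<omega>) (\<lambda>n. g n \<omega>) (Z0 \<omega>) j)" for j \<omega>
    by (simp add: U_def Zseq_eq_walk[OF V_pd V_diag])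
  have H_walk: "H j \<omega> = h (S *v walk f (\<lambda>n. I n \<omega>) (\<lambda>n. g n \<omega>) 0 j)" for j \<omega>
    by (simp add: H_def Xseq_eq_walk[OF V_pd V_diag])
  have U_0: "U 0 \<omega> = h (S *v Z0 \<omega>)" for \<omega> by (simp add: U_walk)
  have [measurable]: "(\<lambda>\<omega>. walk f (\<lambda>n. I n \<omega>) (\<lambda>n. g n \<omega>) (Z0 \<omega>) j) \<in> borel_measurable M"
    "(\<lambda>\<omega>. walk f (\<lambda>n. I n \<omega>) (\<lambda>n. g n \<omega>) 0 j) \<in> borel_measurable M" for j
    by (rule measurable_walk; simp)+
  have U_meas[measurable]: "U j \<in> borel_measurable M" and H_meas[measurable]: "H j \<in> borel_measurable M" for j
    unfolding U_walk H_walk by measurable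
  obtain C r where C: "0 \<le> C" and r: "0 < r" "r < 1"
    and bound: "\<And>j. (\<integral>\<^sup>+\<omega>. ennreal ((H j \<omega> - U j \<omega>)\<^sup>2) \<partial>M) \<le> ennreal (C * (r ^ j)\<^sup>2)"
    unfolding U_walk H_walk using chain_L2_contraction[OF h_lip \<gamma>] by blast
  have HU_sq: "integrable M (\<lambda>\<omega>. (H j \<omega> - U j \<omega>)\<^sup>2)" for j
    using bound[of j] by (intro integrableI_bounded) (auto simp: top_unique less_top[symmetric])
  have HU_bound: "expectation (\<lambda>\<omega>. (H j \<omega> - U j \<omega>)\<^sup>2) \<le> C * (r ^ j)\<^sup>2" for j
    using bound[of j] C by (subst (asm) nn_integral_eq_integral[OF HU_sq]) auto
  \<comment> \<open>At time 0 the comparison chain sits at 0, so \<open>H 0\<close> is the constant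
    h(0). The finite mean square distance between \<open>H 0\<close> and \<open>U 0\<close> then
    makes \<open>U 0\<close> square integrable.\<close>
  have "integrable M (\<lambda>\<omega>. (U 0 \<omega>)\<^sup>2)"
  proof -
    have "integrable M (\<lambda>\<omega>. (H 0 \<omega>)\<^sup>2)" unfolding H_walk by simp
    moreover have "integrable M (\<lambda>\<omega>. (- (H 0 \<omega> - U 0 \<omega>))\<^sup>2)" using HU_sq[of 0] by (simp only: power2_minus)
    ultimately have "integrable M (\<lambda>\<omega>. (H 0 \<omega> + - (H 0 \<omega> - U 0 \<omega>))\<^sup>2)"
      by (intro integrable_square_add) auto
    then show ?thesis by simp
  qed
  then have U_sq: "integrable M (\<lambda>\<omega>. (U j \<omega>)\<^sup>2)" for j
    using stationary_pair(1)[of "\<lambda>x y. (h (S *v x))\<^sup>2" j 0] by (simp add: U_eq U_0)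
  show U_mean: "expectation (U j) = m" for j
    using stationary_pair(2)[of "\<lambda>x y. h (S *v x)" j 0] by (simp add: U_eq m_def)
  have U_corr: "expectation (\<lambda>\<omega>. U j \<omega> * U (j + k) \<omega>) = expectation (\<lambda>\<omega>. U 0 \<omega> * U k \<omega>)" for j k
    using stationary_pair(2)[of "\<lambda>x y. h (S *v x) * h (S *v y)" j k]
    by (simp add: U_eq U_0)
  have U_int: "integrable M (U 0)"
    using integrable_mult_of_squares[of "U 0" M "\<lambda>_. 1"] U_sq by simp
  have H_int: "integrable M (H j)" for j
  proof -
    have "integrable M (\<lambda>\<omega>. (H j \<omega> - U j \<omega>) * 1)" "integrable M (\<lambda>\<omega>. U j \<omega> * 1)"
      by (rule integrable_mult_of_squares; use HU_sq U_sq in simp)+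
    then have "integrable M (\<lambda>\<omega>. (H j \<omega> - U j \<omega>) + U j \<omega>)"
      by (intro Bochner_Integration.integrable_add) simp_all
    then show ?thesis by simp
  qed
  \<comment> \<open>\<open>U 0\<close> is a function of Z_0 and \<open>H j\<close> a function of
    indices and noise, so independence factorises the expectation.\<close>
  have UH: "expectation (\<lambda>\<omega>. U 0 \<omega> * H j \<omega>) = m * expectation (H j)" for j
  proof -
    have walk_meas: "(\<lambda>x. walk f (fst x) (snd x) 0 j) \<in> borel_measurable (index_law \<Otimes>\<^sub>M noise_law)"
      by (rule measurable_walk) measurable
    have "indep_var borel (\<lambda>\<omega>. h (S *v Z0 \<omega>)) borel
        (\<lambda>\<omega>. h (S *v walk f (fst (\<lambda>n. I n \<omega>, \<lambda>n. g n \<omega>)) (snd (\<lambda>n. I n \<omega>, \<lambda>n. g n \<omega>)) 0 j))"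
    proof (rule indep_noise_Z0[of "\<lambda>x. h (S *v walk f (fst x) (snd x) 0 j)"])
      have hS: "(\<lambda>x. h (S *v x)) \<in> borel_measurable borel" by measurable
      show "(\<lambda>x. h (S *v walk f (fst x) (snd x) 0 j)) \<in> borel_measurable (index_law \<Otimes>\<^sub>M noise_law)"
        by (rule measurable_compose[OF walk_meas hS])
      show "(\<lambda>x. h (S *v x)) \<in> borel_measurable std_gauss"
        using hS by (simp cong: measurable_cong_sets)
    qed
    moreover have "U 0 = (\<lambda>\<omega>. h (S *v Z0 \<omega>))" by (rule ext) (rule U_0)
    moreover have "H j = (\<lambda>\<omega>. h (S *v walk f (\<lambda>n. I n \<omega>) (\<lambda>n. g n \<omega>) 0 j))" by (rule ext) (rule H_walk)
    ultimately have "indep_var borel (U 0) borel (H j)" by simp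
    from indep_var_lebesgue_integral[OF this U_int H_int] show ?thesis by (simp add: U_mean)
  qed
  note lim = scaled_mean_square_limit[of U H C r m, OF U_meas H_meas U_sq HU_sq HU_bound r U_mean U_corr UH]
  show "summable (\<lambda>j. cov (Suc j))"
    using lim(1) by (simp add: cov_def)
  show "(\<lambda>n. real n * expectation (\<lambda>\<omega>. ((\<Sum>j<n. h (Xseq V I g j \<omega>)) / real n - m)\<^sup>2))
      \<longlonglongrightarrow> cov 0 + 2 * (\<Sum>j. cov (Suc j))"
    using lim(2) by (simp add: cov_def H_def)
qed

end

theorem theorem5p1:
  fixes M :: "'a measure"
    and V :: "real^'n^'n"
    and I :: "nat \<Rightarrow> 'a \<Rightarrow> 'n"
    and g :: "nat \<Rightarrow> 'a \<Rightarrow> real"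
    and Zc :: "'n \<Rightarrow> 'a \<Rightarrow> real"
    and h :: "real^'n \<Rightarrow> real"
    and \<kappa> \<gamma> :: real
  defines "Z0 \<equiv> (\<lambda>\<omega>. \<chi> k. Zc k \<omega>)"
    and "G \<equiv> (\<lambda>j::nat + 'n. case j of Inl n \<Rightarrow> g n | Inr k \<Rightarrow> Zc k)"
  assumes M: "prob_space M"
    and V_pd: "pd_mat V" and V_diag: "\<forall>i. V $ i $ i = 1"
    and I_meas: "\<forall>n. I n \<in> measurable M (count_space UNIV)"
    and I_unif: "\<forall>n k. measure M {\<omega> \<in> space M. I n \<omega> = k} = 1 / real CARD('n)"
    and I_indep: "prob_space.indep_vars M (\<lambda>_. count_space UNIV) I UNIV"
    and G_meas: "\<forall>j. G j \<in> borel_measurable M"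
    and G_normal: "\<forall>j. distr M borel (G j) = density lborel std_normal_density"
    and G_indep: "prob_space.indep_vars M (\<lambda>_. borel) G UNIV"
    and IG_indep: "prob_space.indep_set M
                     (sets (vimage_algebra (space M) (\<lambda>\<omega> n. I n \<omega>) (PiM UNIV (\<lambda>_. count_space UNIV))))
                     (sets (vimage_algebra (space M) (\<lambda>\<omega> j. G j \<omega>) (PiM UNIV (\<lambda>_. borel))))"
    and \<kappa>_pos: "\<kappa> > 0" and \<gamma>_pos: "0 < \<gamma>" and \<gamma>_le: "\<gamma> \<le> 1"
    and h_lip: "gauss_lipschitz \<kappa> \<gamma> V h"
  shows
    "let S = mat_sqrt V;
         U = (\<lambda>j \<omega>. h (S *v Zseq V I g Z0 j \<omega>));
         m = (\<integral>\<omega>. h (S *v Z0 \<omega>) \<partial>M);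
         cov = (\<lambda>j. \<integral>\<omega>. (U 0 \<omega> - (\<integral>\<omega>'. U 0 \<omega>' \<partial>M)) * (U j \<omega> - (\<integral>\<omega>'. U j \<omega>' \<partial>M)) \<partial>M);
         c = cov 0 + 2 * (\<Sum>j. cov (Suc j))
     in summable (\<lambda>j. cov (Suc j)) \<and>
        (\<lambda>n. real n * (\<integral>\<omega>. ((\<Sum>j<n. h (Xseq V I g j \<omega>)) / real n - m)\<^sup>2 \<partial>M))
          \<longlonglongrightarrow> c"
proof -
  have G_eq: "G = case_sum g Zc" by (simp add: G_def fun_eq_iff)
  interpret chain: gaussian_chain M V I g Zc
  proof (intro gaussian_chain.intro gaussian_chain_axioms.intro M V_pd V_diag I_meas I_unif I_indep)
    show "\<forall>j. case_sum g Zc j \<in> borel_measurable M" using G_meas unfolding G_eq .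
    show "\<forall>j. distr M borel (case_sum g Zc j) = std_normal_distribution" using G_normal unfolding G_eq .
    show "prob_space.indep_vars M (\<lambda>_. borel) (case_sum g Zc) UNIV" using G_indep unfolding G_eq .
    show "prob_space.indep_set M
        (sets (vimage_algebra (space M) (\<lambda>\<omega> n. I n \<omega>) (PiM UNIV (\<lambda>_. count_space UNIV))))
        (sets (vimage_algebra (space M) (\<lambda>\<omega> j. case_sum g Zc j \<omega>) (PiM UNIV (\<lambda>_. borel))))"
      using IG_indep unfolding G_eq .
  qed
  note result = chain.scaled_mean_square_limit_chain[OF h_lip \<gamma>_pos \<gamma>_le]
  show ?thesis
    \<comment> \<open>The covariances are centred at the means of \<open>U 0\<close> and
      \<open>U j\<close>; stationarity makes both equal to m, the mean of h under the law N(0, V) of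
      S Z_0.\<close>
    unfolding Let_def Z0_def result(1) using result(2,3) by blast
qed

end
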